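(* Let $\Theta_1,\Theta_2,\ldots$ be independent random variables with $\mathbb P(\Theta_j\le\theta)=\theta/(\theta+j-1)$ for $\theta\ge0$ (with the convention $0/0=1$, so $\Theta_1=0$ a.s.). For each $n\ge1$ and $\theta\ge0$, let $C_{n,\theta}$ be the random composition of $n$ whose binary representation is the sequence $(1(\Theta_j\le\theta))_{1\le j\le n}$, and let $(\Pi_{n,\theta},\theta\ge0)$ be the partition-valued process associated with $(C_{n,\theta},\theta\ge0)$. Then the sequence of processes $(\Pi_{n,\theta},\theta\ge0)$, $n=1,2,\ldots$, is a family of Ewens fragmentations.
   Context: A composition of $n$ is a sequence of positive integers $(n_1,\ldots,n_k)$ with sum $n$, viewed as $n$ unlabelled balls placed in an ordered sequence of $k$ nonempty boxes, the $i$th box containing $n_i$ balls. Its binary representation is the length-$n$ 0/1 sequence obtained by concatenating the words $10^{n_1-1},10^{n_2-1},\ldots,10^{n_k-1}$, i.e. the $1$'s are at positions $1,n_1+1,n_1+n_2+1,\ldots,n_1+\cdots+n_{k-1}+1$; conversely every 0/1 sequence of length $n$ starting with $1$ encodes a composition of $n$. Given a process $(C_{n,\theta},\theta\ge0)$ of compositions of $n$, the associated partition-valued process $(\Pi_{n,\theta},\theta\ge0)$ is obtained by labelling the $n$ ball positions (in left-to-right order across the boxes) by $\sigma(1),\ldots,\sigma(n)$, where $\sigma$ is a uniform random permutation of $[n]=\{1,\ldots,n\}$ independent of the composition process (the same $\sigma$ for all $\theta$), and then forgetting the order of the boxes, so that the sets of labels in the boxes form a partition of $[n]$. A family of Ewens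 fragmentations is a sequence, indexed by $n=1,2,\ldots$, of processes $(\Pi_{n,\theta},\theta\ge0)$ such that: (1) for each $n$ and $\theta\ge0$, $\Pi_{n,\theta}$ is a random partition of $[n]$ with $\mathbb P(\Pi_{n,\theta}=\pi)=\frac{\theta^{k-1}}{[\theta+1]_{n-1}}\prod_{i=1}^k(n_i-1)!$ for every partition $\pi$ of $[n]$ into $k$ blocks of sizes $n_1,\ldots,n_k$, where $[x]_m=x(x+1)\cdots(x+m-1)$; (2) for all $n$, $\Pi_{n,\theta}$ is a refinement of $\Pi_{n,\phi}$ whenever $\theta>\phi$ (each block of $\Pi_{n,\phi}$ is a union of blocks of $\Pi_{n,\theta}$); (3) for each $n<m$, the restriction of $(\Pi_{m,\theta},\theta\ge0)$ to $[n]$ has the same distribution (as a process) as $(\Pi_{n,\theta},\theta\ge0)$; (4) for each $n$ the law of $(\Pi_{n,\theta},\theta\ge0)$ is invariant under permutations of $[n]$. *)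

theory Defs
  imports "HOL-Probability.Probability" "HOL-Combinatorics.Permutations" "HOL-Library.Disjoint_Sets"
begin

text \<open>Composition encoded by a 0/1 word (True = 1).  A word starting with 1 is decoded
  into the list of box sizes; a (null-event) leading 0 is treated as if it were a 1.\<close>
function bin_to_comp :: "bool list \<Rightarrow> nat list" where
  "bin_to_comp [] = []"
| "bin_to_comp (b # bs) = Suc (length (takeWhile Not bs)) # bin_to_comp (dropWhile Not bs)"
  by pat_completeness auto
termination
  by (relation "Wellfounded.measure length") (auto simp: le_imp_less_Suc length_dropWhile_le)

definition comp_boxes :: "nat list \<Rightarrow> nat set list" where
  "comp_boxes c = map (\<lambda>i. {sum_list (take i c) + 1 .. sum_list (take (Suc i) c)}) [0..<length c]"

definition assoc_partition :: "(nat \<Rightarrow> nat) \<Rightarrow> nat list \<Rightarrow> nat set set" where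
  "assoc_partition \<sigma> c = (\<lambda>B. \<sigma> ` B) ` set (comp_boxes c)"

definition Theta_cdf :: "nat \<Rightarrow> real \<Rightarrow> real" where
  "Theta_cdf j \<theta> = (if \<theta> + real j - 1 = 0 then 1 else \<theta> / (\<theta> + real j - 1))"

definition C_proc :: "(nat \<Rightarrow> 'a \<Rightarrow> real) \<Rightarrow> nat \<Rightarrow> real \<Rightarrow> 'a \<Rightarrow> nat list" where
  "C_proc \<Theta> n \<theta> \<omega> = bin_to_comp (map (\<lambda>j. \<Theta> j \<omega> \<le> \<theta>) [1..<Suc n])"

definition Pi_proc :: "(nat \<Rightarrow> 'a \<Rightarrow> real) \<Rightarrow> (nat \<Rightarrow> 'a \<Rightarrow> nat \<Rightarrow> nat) \<Rightarrow> nat \<Rightarrow> real \<Rightarrow> 'a \<Rightarrow> nat set set" where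
  "Pi_proc \<Theta> \<sigma> n \<theta> \<omega> = assoc_partition (\<sigma> n \<omega>) (C_proc \<Theta> n \<theta> \<omega>)"

definition refines :: "'b set set \<Rightarrow> 'b set set \<Rightarrow> bool" where
  "refines P Q \<longleftrightarrow> (\<forall>C\<in>Q. \<exists>S\<subseteq>P. C = \<Union>S)"

definition restrict_part :: "nat \<Rightarrow> nat set set \<Rightarrow> nat set set" where
  "restrict_part n P = (\<lambda>B. B \<inter> {1..n}) ` P - {{}}"

definition relabel :: "(nat \<Rightarrow> nat) \<Rightarrow> nat set set \<Rightarrow> nat set set" where
  "relabel \<tau> P = (\<lambda>B. \<tau> ` B) ` P"

text \<open>Family of Ewens fragmentations; laws of processes compared through their
  finite-dimensional distributions over times \<theta> \<ge> 0.\<close>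
definition ewens_fragmentation_family ::
  "'a measure \<Rightarrow> (nat \<Rightarrow> real \<Rightarrow> 'a \<Rightarrow> nat set set) \<Rightarrow> bool" where
  "ewens_fragmentation_family M P \<longleftrightarrow>
    (\<forall>n\<ge>1. \<forall>\<theta>::real. \<theta> \<ge> 0 \<longrightarrow> (\<forall>\<pi>. partition_on {1..n} \<pi> \<longrightarrow>
        measure M {\<omega> \<in> space M. P n \<theta> \<omega> = \<pi>}
          = \<theta> ^ (card \<pi> - 1) / pochhammer (\<theta> + 1) (n - 1) * (\<Prod>B\<in>\<pi>. fact (card B - 1)))) \<and>
    (\<forall>n\<ge>1. AE \<omega> in M. \<forall>\<theta> \<phi>. 0 \<le> \<phi> \<and> \<phi> < \<theta> \<longrightarrow> refines (P n \<theta> \<omega>) (P n \<phi> \<omega>)) \<and>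
    (\<forall>n m. 1 \<le> n \<and> n < m \<longrightarrow> (\<forall>ts. list_all (\<lambda>t. 0 \<le> t) ts \<longrightarrow>
        distr M (count_space UNIV) (\<lambda>\<omega>. map (\<lambda>t. restrict_part n (P m t \<omega>)) ts)
        = distr M (count_space UNIV) (\<lambda>\<omega>. map (\<lambda>t. P n t \<omega>) ts))) \<and>
    (\<forall>n\<ge>1. \<forall>\<tau>. \<tau> permutes {1..n} \<longrightarrow> (\<forall>ts. list_all (\<lambda>t. 0 \<le> t) ts \<longrightarrow>
        distr M (count_space UNIV) (\<lambda>\<omega>. map (\<lambda>t. relabel \<tau> (P n t \<omega>)) ts)
        = distr M (count_space UNIV) (\<lambda>\<omega>. map (\<lambda>t. P n t \<omega>) ts)))"

end

theory Submission
  imports Defs "HOL-Combinatorics.Multiset_Permutations"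
begin

text \<open>Balls are added one at a time at the right end: the \<open>j\<close>-th ball opens a new box iff the
  \<open>j\<close>-th letter is 1. Marginal law: removing the last ball shows by induction that, given the
  partition, the last box is a size-biased pick, which yields the joint law of partition and last
  box. Refinement is monotonicity of the letters in \<open>\<theta>\<close>. Exchangeability is invariance of the
  uniform permutation. Consistency: deleting the ball at position \<open>p\<close> replaces
  \<open>\<Theta>\<^sub>p, \<Theta>\<^sub>p\<^sub>+\<^sub>1\<close> by their minimum, and label \<open>n + 1\<close> sits at a uniform position. With
  \<open>\<mu>\<^sub>j\<close> the law of \<open>\<Theta>\<^sub>j\<close>, the law is preserved because
  \<open>n \<mu>\<^sub>n\<^sub>+\<^sub>2 + law (min \<Theta>\<^sub>n\<^sub>+\<^sub>1 \<Theta>\<^sub>n\<^sub>+\<^sub>2) = (n + 1) \<mu>\<^sub>n\<^sub>+\<^sub>1\<close> for all \<open>n\<close>.\<close>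

section \<open>Boxes built ball by ball\<close>

text \<open>Deleting a ball at a fixed interior position does not in general keep the law of the
  word, because each later letter moves one place to the left and keeps its own threshold. Only the
  average over the position is invariant, and an identity for one letter must be carried to whole
  words. The deletions that leave the last letter alone give, by induction, n copies of the product
  law of the shorter word, each followed by a letter with the law of index n + 2; the deletion that
  merges the last two letters adds the law of the minimum. The survival function of that minimum at
  a is n (n + 1) / ((a + n) (a + n + 1)), so the identity is one between rational functions. For the
  law of the process, and not just of one time, a letter is the vector of comparisons of a threshold
  with all chosen times. Merging is then entrywise disjunction, which is the comparison vector of
  the minimum. As letters and permutations are finite in number, all laws become finite
  sums.\<close>

text \<open>The most recent box is at the head of the list.\<close>

fun add_ball :: "'b set list \<Rightarrow> 'b \<times> bool \<Rightarrow> 'b set list" where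
  "add_ball [] (x, b) = [{x}]"
| "add_ball (B # Bs) (x, b) = (if b then {x} # B # Bs else insert x B # Bs)"

definition boxes :: "'b list \<Rightarrow> bool list \<Rightarrow> 'b set list" where
  "boxes xs bs = foldl add_ball [] (zip xs bs)"

lemma boxes_Nil [simp]: "boxes [] bs = []"
  by (simp add: boxes_def)

lemma boxes_snoc [simp]:
  "length xs = length bs \<Longrightarrow> boxes (xs @ [x]) (bs @ [b]) = add_ball (boxes xs bs) (x, b)"
  by (simp add: boxes_def)

lemma boxes_single [simp]: "boxes [x] [b] = [{x}]"
  by (simp add: boxes_def)

lemma add_ball_True [simp]: "add_ball Bs (x, True) = {x} # Bs"
  by (cases Bs) auto

section \<open>Decoding a word from its right end\<close>

lemma sum_list_bin_to_comp [simp]: "sum_list (bin_to_comp bs) = length bs"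
proof (induction bs rule: bin_to_comp.induct)
  case (2 b bs)
  have "length (takeWhile Not bs) + length (dropWhile Not bs) = length bs"
    by (metis length_append takeWhile_dropWhile_id)
  with 2 show ?case by simp
qed simp

lemma bin_to_comp_eq_Nil [simp]: "bin_to_comp bs = [] \<longleftrightarrow> bs = []"
  by (cases bs) auto

text \<open>\<open>bin_to_comp\<close> reads from the left while balls arrive at the right, so an
  appended letter needs its own induction. The case split is whether the first box ends before the
  appended letter.\<close>

lemma bin_to_comp_snoc_True: "bin_to_comp (bs @ [True]) = bin_to_comp bs @ [1]"
proof (induction bs rule: bin_to_comp.induct)
  case (2 b bs)
  show ?case
  proof (cases "\<exists>x\<in>set bs. x")
    case True
    then have "takeWhile Not (bs @ [True]) = takeWhile Not bs"
      "dropWhile Not (bs @ [True]) = dropWhile Not bs @ [True]"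
      by (auto simp: takeWhile_append dropWhile_append)
    with 2 show ?thesis by simp
  next
    case False
    then have "length (takeWhile Not (bs @ [True])) = length bs" "dropWhile Not (bs @ [True]) = [True]"
      "length (takeWhile Not bs) = length bs" "dropWhile Not bs = []"
      by (auto simp: takeWhile_append dropWhile_append intro!: arg_cong[where f = length])
    then show ?thesis by (simp del: dropWhile_eq_Nil_conv)
  qed
qed simp

lemma bin_to_comp_snoc_False:
  "bs \<noteq> [] \<Longrightarrow>
   bin_to_comp (bs @ [False]) = butlast (bin_to_comp bs) @ [Suc (last (bin_to_comp bs))]"
proof (induction bs rule: bin_to_comp.induct)
  case (2 b bs)
  show ?case
  proof (cases "\<exists>x\<in>set bs. x")
    case True
    then have "takeWhile Not (bs @ [False]) = takeWhile Not bs"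
      "dropWhile Not (bs @ [False]) = dropWhile Not bs @ [False]" "dropWhile Not bs \<noteq> []"
      by (auto simp: takeWhile_append dropWhile_append)
    with 2 show ?thesis by (simp del: dropWhile_eq_Nil_conv)
  next
    case False
    then have "length (takeWhile Not (bs @ [False])) = Suc (length bs)" "dropWhile Not (bs @ [False]) = []"
      "length (takeWhile Not bs) = length bs" "dropWhile Not bs = []"
      by (auto simp: takeWhile_append dropWhile_append intro!: arg_cong[where f = length])
    then show ?thesis by (simp del: dropWhile_eq_Nil_conv)
  qed
qed simp

lemma comp_boxes_snoc:
  "comp_boxes (c @ [m]) = comp_boxes c @ [{sum_list c + 1..sum_list c + m}]"
  by (auto simp: comp_boxes_def)

text \<open>The bridge from intervals of positions to the recursion on which the later inductions
  run. The reversal is there because the newest box is at the head.\<close>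

lemma comp_boxes_bin_to_comp:
  "comp_boxes (bin_to_comp bs) = rev (boxes [1..<Suc (length bs)] bs)"
proof (induction bs rule: rev_induct)
  case Nil
  show ?case by (simp add: comp_boxes_def)
next
  case (snoc b bs)
  have snoc': "boxes [1..<Suc (length (bs @ [b]))] (bs @ [b]) =
      add_ball (boxes [1..<Suc (length bs)] bs) (Suc (length bs), b)"
    using boxes_snoc[of "[1..<Suc (length bs)]" bs "Suc (length bs)" b]
    by (simp del: boxes_snoc upt_Suc add: upt_Suc_append)
  consider "b" | "\<not> b" "bs = []" | "\<not> b" "bs \<noteq> []" by blast
  then show ?case
  proof cases
    case 1
    with snoc show ?thesis
      unfolding snoc' by (simp add: bin_to_comp_snoc_True comp_boxes_snoc)
  next
    \<comment> \<open>A leading 0 opens a box on both sides: \<open>add_ball []\<close> and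
      \<open>bin_to_comp\<close> both ignore the first letter.\<close>
    case 2
    then show ?thesis
      unfolding snoc' by (simp add: comp_boxes_def)
  next
    case 3
    define c m where "c = butlast (bin_to_comp bs)" and "m = last (bin_to_comp bs)"
    have c: "bin_to_comp bs = c @ [m]"
      using 3 by (simp add: c_def m_def)
    then have len: "length bs = sum_list c + m"
      using sum_list_bin_to_comp[of bs] by simp
    from snoc have "rev (boxes [1..<Suc (length bs)] bs) =
        comp_boxes c @ [{sum_list c + 1..sum_list c + m}]"
      by (simp add: c comp_boxes_snoc)
    then have "boxes [1..<Suc (length bs)] bs =
        {sum_list c + 1..sum_list c + m} # rev (comp_boxes c)"
      by (simp add: rev_swap)
    with 3 c len show ?thesis
      unfolding snoc'
      by (auto simp: bin_to_comp_snoc_False comp_boxes_snoc atLeastAtMostSuc_conv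
          simp del: upt_Suc)
  qed
qed

section \<open>Labels, refinement and the partition property\<close>

lemma boxes_map:
  "length xs = length bs \<Longrightarrow> boxes (map f xs) bs = map ((`) f) (boxes xs bs)"
proof (induction xs bs rule: rev_induct2)
  case (4 x xs b bs)
  then show ?case
    by (cases "boxes xs bs") auto
qed (auto simp: boxes_def)

text \<open>Balls are labelled before boxing instead of after. From here on the permutation enters
  only as the list of labels in order of position.\<close>

lemma assoc_partition_eq_boxes:
  "assoc_partition \<sigma> (bin_to_comp bs) = set (boxes (map \<sigma> [1..<Suc (length bs)]) bs)"
  by (subst boxes_map)
    (auto simp: assoc_partition_def comp_boxes_bin_to_comp simp del: upt_Suc)

lemma relabel_boxes:
  "length xs = length bs \<Longrightarrow> relabel \<tau> (set (boxes xs bs)) = set (boxes (map \<tau> xs) bs)"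
  by (simp add: relabel_def boxes_map)

text \<open>Each list in \<open>gs\<close> consists of the finer boxes into which one coarser box is cut.\<close>

lemma boxes_grouping:
  assumes "length bs = length xs" "list_all2 (\<longrightarrow>) bs bs'"
  shows "\<exists>gs. (\<forall>g\<in>set gs. g \<noteq> []) \<and> boxes xs bs' = concat gs \<and>
    boxes xs bs = map (\<lambda>g. \<Union>(set g)) gs"
  using assms
proof (induction xs arbitrary: bs bs' rule: rev_induct)
  case Nil
  then show ?case by simp
next
  case (snoc x xs)
  then obtain cs c where bs: "bs = cs @ [c]" "length cs = length xs"
    by (metis length_append_singleton length_Suc_conv_rev)
  then obtain cs' c' where bs': "bs' = cs' @ [c']" "list_all2 (\<longrightarrow>) cs cs'" "c \<longrightarrow> c'"
    using snoc.prems(2) by (auto simp: list_all2_append1 list_all2_Cons1)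
  have len: "length cs' = length xs"
    using bs bs' by (metis list_all2_lengthD)
  from snoc.IH[OF bs(2) bs'(2)] obtain gs where
    gs: "\<forall>g\<in>set gs. g \<noteq> []" "boxes xs cs' = concat gs" "boxes xs cs = map (\<lambda>g. \<Union>(set g)) gs"
    by blast
  show ?case
  proof (cases "c \<or> gs = []")
    case True
    then show ?thesis
      using bs bs' gs len by (intro exI[of _ "[{x}] # gs"]) auto
  next
    \<comment> \<open>The coarse word opens no box, so the ball stays in the newest group; the fine
      word may still cut it off inside that group.\<close>
    case False
    then obtain B g gs' where gs': "gs = (B # g) # gs'"
      using gs(1) by (metis list.set_intros(1) neq_Nil_conv)
    show ?thesis
    proof (cases c')
      case True
      then show ?thesis
        using False bs bs' gs len gs' by (intro exI[of _ "({x} # B # g) # gs'"]) auto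
    next
      case c': False
      then show ?thesis
        using False bs bs' gs len gs' by (intro exI[of _ "(insert x B # g) # gs'"]) auto
    qed
  qed
qed

lemma refines_boxes:
  assumes "length bs = length xs" "list_all2 (\<longrightarrow>) bs bs'"
  shows "refines (set (boxes xs bs')) (set (boxes xs bs))"
proof -
  from boxes_grouping[OF assms] obtain gs where
    "boxes xs bs' = concat gs" "boxes xs bs = map (\<lambda>g. \<Union>(set g)) gs" by blast
  then show ?thesis
    unfolding refines_def by auto
qed

text \<open>Distinctness is recorded as well because later the set of boxes is split into the newest
  box and the set of the others.\<close>

lemma boxes_partition:
  assumes "length bs = length xs" "distinct xs"
  shows "distinct (boxes xs bs)" "partition_on (set xs) (set (boxes xs bs))"
proof -
  have "distinct (boxes xs bs) \<and> partition_on (set xs) (set (boxes xs bs))"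
    using assms
  proof (induction xs arbitrary: bs rule: rev_induct)
    case Nil
    then show ?case by (simp add: partition_on_def)
  next
    case (snoc x xs)
    then obtain cs c where bs: "bs = cs @ [c]" "length cs = length xs"
      by (metis length_append_singleton length_Suc_conv_rev)
    with snoc have IH: "distinct (boxes xs cs)" "partition_on (set xs) (set (boxes xs cs))"
      by auto
    have x: "x \<notin> set xs" using snoc.prems by simp
    show ?case
    proof (cases "boxes xs cs")
      case Nil
      with IH have "set xs = {}" by (auto simp: partition_on_def)
      with bs Nil show ?thesis by (auto simp: partition_on_def)
    next
      case (Cons B Bs)
      with IH have *: "B \<notin> set Bs" "distinct Bs" "set xs = B \<union> \<Union>(set Bs)" "B \<noteq> {}" "{} \<notin> set Bs"
        "disjoint (insert B (set Bs))"
        by (auto simp: partition_on_def)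
      from *(6,1) have "\<forall>C\<in>set Bs. B \<inter> C = {}" "disjoint (set Bs)"
        by (auto simp: disjoint_def)
      with * bs Cons x show ?thesis
        by (auto simp: partition_on_def disjoint_def)
    qed
  qed
  then show "distinct (boxes xs bs)" "partition_on (set xs) (set (boxes xs bs))"
    by auto
qed

section \<open>Deleting a ball\<close>

text \<open>The list counterpart of restricting to one label fewer. Keeping the order of the boxes
  lets it commute with further \<open>add_ball\<close> steps.\<close>

definition erase :: "'b \<Rightarrow> 'b set list \<Rightarrow> 'b set list" where
  "erase z Bs = filter (\<lambda>B. B \<noteq> {}) (map (\<lambda>B. B - {z}) Bs)"

text \<open>What deleting the ball at place \<open>p\<close>, counted from 0, does to the word: its
  letter is absorbed by the right neighbour, or dropped if there is none. The operation
  \<open>f\<close> is disjunction for one time and entrywise disjunction for several.\<close>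

definition merge_at :: "('v \<Rightarrow> 'v \<Rightarrow> 'v) \<Rightarrow> nat \<Rightarrow> 'v list \<Rightarrow> 'v list" where
  "merge_at f p vs = (if Suc p < length vs
     then take p vs @ f (vs ! p) (vs ! Suc p) # drop (Suc (Suc p)) vs else butlast vs)"

lemma boxes_subset_nonempty:
  "length bs = length xs \<Longrightarrow> B \<in> set (boxes xs bs) \<Longrightarrow> B \<subseteq> set xs \<and> B \<noteq> {}"
proof (induction xs arbitrary: bs B rule: rev_induct)
  case (snoc x xs)
  then obtain cs c where bs: "bs = cs @ [c]" "length cs = length xs"
    by (metis length_append_singleton length_Suc_conv_rev)
  show ?case
  proof (cases "boxes xs cs")
    case Nil
    with bs snoc.prems show ?thesis by auto
  next
    case (Cons C Cs)
    with snoc.IH[OF bs(2)] have "C \<subseteq> set xs" "\<And>D. D \<in> set Cs \<Longrightarrow> D \<subseteq> set xs \<and> D \<noteq> {}"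
      "C \<noteq> {}"
      by auto
    with bs snoc.prems Cons show ?thesis by (fastforce split: if_splits)
  qed
qed simp

lemma erase_boxes_id:
  "length bs = length xs \<Longrightarrow> z \<notin> set xs \<Longrightarrow> erase z (boxes xs bs) = boxes xs bs"
proof -
  assume "length bs = length xs" "z \<notin> set xs"
  then have *: "\<And>B. B \<in> set (boxes xs bs) \<Longrightarrow> B - {z} = B \<and> B \<noteq> {}"
    using boxes_subset_nonempty by (metis Diff_empty Diff_insert0 subsetD)
  then have "map (\<lambda>B. B - {z}) (boxes xs bs) = boxes xs bs"
    by (intro map_idI) blast
  with * show ?thesis
    unfolding erase_def by (simp only: filter_id_conv) blast
qed

text \<open>The newest box must keep a ball other than \<open>z\<close>. If it vanished under
  \<open>erase\<close>, a following ball with letter 0 would fall into the box before it.\<close>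

lemma erase_foldl_add_ball:
  assumes "z \<notin> fst ` set zs" "\<not> B \<subseteq> {z}"
  shows "erase z (foldl add_ball (B # Bs) zs) = foldl add_ball (erase z (B # Bs)) zs"
  using assms
proof (induction zs arbitrary: B Bs)
  case (Cons y zs)
  obtain x b where y: "y = (x, b)" by force
  have [simp]: "x \<noteq> z" using Cons.prems y by auto
  have B: "B - {z} \<noteq> {}" using Cons.prems by auto
  show ?case
  proof (cases b)
    case True
    then have "foldl add_ball (B # Bs) (y # zs) = foldl add_ball ({x} # B # Bs) zs"
      by (simp add: y)
    also have "erase z \<dots> = foldl add_ball (erase z ({x} # B # Bs)) zs"
      using Cons.prems by (intro Cons.IH) auto
    also have "erase z ({x} # B # Bs) = add_ball (erase z (B # Bs)) y"
      using B True by (simp add: erase_def y insert_Diff_if)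
    finally show ?thesis by simp
  next
    case False
    then have "foldl add_ball (B # Bs) (y # zs) = foldl add_ball (insert x B # Bs) zs"
      by (simp add: y)
    also have "erase z \<dots> = foldl add_ball (erase z (insert x B # Bs)) zs"
      using Cons.prems by (intro Cons.IH) auto
    also have "erase z (insert x B # Bs) = add_ball (erase z (B # Bs)) y"
      using B False by (auto simp add: erase_def y insert_Diff_if)
    finally show ?thesis by simp
  qed
qed simp

lemma erase_boxes_last:
  assumes "length bs = length xs" "z \<notin> set xs"
  shows "erase z (boxes (xs @ [z]) (bs @ [b])) = boxes xs bs"
proof -
  have *: "erase z (boxes xs bs) = boxes xs bs" using assms by (rule erase_boxes_id)
  show ?thesis
  proof (cases "boxes xs bs")
    case Nil
    with assms show ?thesis by (simp add: erase_def)
  next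
    case (Cons B Bs)
    have "B \<subseteq> set xs" "B \<noteq> {}"
      using boxes_subset_nonempty[OF assms(1), of B] Cons by auto
    with assms have "B - {z} = B" by auto
    with Cons assms \<open>B \<noteq> {}\<close> * show ?thesis by (auto simp add: erase_def insert_Diff_if)
  qed
qed

text \<open>Without \<open>z\<close>, the ball \<open>y\<close> is the first of its box iff it
  opened one itself or shared a box that \<open>z\<close> had opened; hence the disjunction. Both
  balls are treated together because only once \<open>y\<close> is placed is the newest box sure to
  survive the deletion.\<close>

lemma erase_boxes_middle:
  assumes len: "length bs = length xs" "length ds = length ys" and z: "z \<notin> set (xs @ y # ys)"
  shows "erase z (boxes (xs @ z # y # ys) (bs @ b # d # ds)) = boxes (xs @ y # ys) (bs @ (b \<or> d) # ds)"
proof -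
  define S where "S = boxes xs bs"
  have S: "erase z S = S"
    unfolding S_def using assms by (intro erase_boxes_id) auto
  have "\<exists>B Bs. add_ball (add_ball S (z, b)) (y, d) = B # Bs \<and> \<not> B \<subseteq> {z} \<and>
      erase z (B # Bs) = add_ball S (y, b \<or> d)"
  proof (cases S)
    case Nil
    with z show ?thesis by (auto simp: erase_def insert_Diff_if)
  next
    case (Cons C Cs)
    have "C \<subseteq> set xs" "C \<noteq> {}"
      using boxes_subset_nonempty[OF len(1), of C] Cons by (auto simp: S_def)
    with z have "C - {z} = C" by auto
    with Cons S \<open>C \<noteq> {}\<close> z show ?thesis
      by (auto simp add: erase_def insert_Diff_if)
  qed
  then obtain B Bs where B: "add_ball (add_ball S (z, b)) (y, d) = B # Bs" "\<not> B \<subseteq> {z}"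
      "erase z (B # Bs) = add_ball S (y, b \<or> d)" by blast
  have "boxes (xs @ z # y # ys) (bs @ b # d # ds) = foldl add_ball (B # Bs) (zip ys ds)"
    using len B(1) by (simp add: boxes_def S_def)
  also have "erase z \<dots> = foldl add_ball (erase z (B # Bs)) (zip ys ds)"
    using z B(2) by (intro erase_foldl_add_ball) (auto dest: set_zip_leftD)
  also have "\<dots> = boxes (xs @ y # ys) (bs @ (b \<or> d) # ds)"
    using len unfolding B(3) by (simp add: boxes_def S_def)
  finally show ?thesis .
qed

lemma erase_boxes_insert:
  assumes "length bs = Suc (length ys)" "p \<le> length ys" "z \<notin> set ys"
  shows "erase z (boxes (take p ys @ z # drop p ys) bs) = boxes ys (merge_at (\<or>) p bs)"
proof (cases "p = length ys")
  case True
  obtain cs c where bs: "bs = cs @ [c]" "length cs = length ys"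
    using assms(1) by (metis length_Suc_conv_rev)
  with erase_boxes_last[OF bs(2) assms(3)] True show ?thesis
    by (simp add: merge_at_def)
next
  case False
  with assms have p: "p < length ys" "Suc p < length bs" by auto
  have bs: "take p bs @ bs ! p # bs ! Suc p # drop (Suc (Suc p)) bs = bs"
    using p by (simp add: Cons_nth_drop_Suc)
  have ys: "drop p ys = ys ! p # drop (Suc p) ys" "take p ys @ ys ! p # drop (Suc p) ys = ys"
    using p by (simp_all add: Cons_nth_drop_Suc)
  have "erase z (boxes (take p ys @ z # ys ! p # drop (Suc p) ys)
      (take p bs @ bs ! p # bs ! Suc p # drop (Suc (Suc p)) bs)) =
    boxes (take p ys @ ys ! p # drop (Suc p) ys)
      (take p bs @ (bs ! p \<or> bs ! Suc p) # drop (Suc (Suc p)) bs)"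
    using p assms by (intro erase_boxes_middle) (auto simp: ys)
  then show ?thesis
    using p by (simp add: bs ys merge_at_def)
qed

lemma restrict_part_boxes_insert:
  assumes "length bs = Suc n" "p \<le> n" "ys \<in> permutations_of_set {1..n}"
  shows "restrict_part n (set (boxes (take p ys @ Suc n # drop p ys) bs)) =
    set (boxes ys (merge_at (\<or>) p bs))"
proof -
  have ys: "set ys = {1..n}" "length ys = n"
    using assms(3) length_finite_permutations_of_set[OF assms(3)] by (auto dest: permutations_of_setD)
  define xs where "xs = take p ys @ Suc n # drop p ys"
  have xs: "set xs \<subseteq> {1..Suc n}"
    using set_take_subset[of p ys] set_drop_subset[of p ys] unfolding ys xs_def by auto
  have len: "length bs = length xs" using assms ys by (simp add: xs_def)
  \<comment> \<open>All labels are at most \<open>Suc n\<close>, so restricting loses that label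
    only.\<close>
  have "B \<inter> {1..n} = B - {Suc n}" if "B \<in> set (boxes xs bs)" for B
    using boxes_subset_nonempty[OF len that] xs by auto
  then have "restrict_part n (set (boxes xs bs)) = set (erase (Suc n) (boxes xs bs))"
    by (auto simp: restrict_part_def erase_def image_iff)
  also have "erase (Suc n) (boxes xs bs) = boxes ys (merge_at (\<or>) p bs)"
    unfolding xs_def using assms ys by (intro erase_boxes_insert) auto
  finally show ?thesis by (simp add: xs_def)
qed

section \<open>Expectations over words with independent letters\<close>

text \<open>For weights summing to 1 this is the expectation of \<open>g\<close> over a word of
  independent letters, the \<open>j\<close>-th of law \<open>q j\<close>, counted from 1. Splitting
  off the last letter matches the recursion of \<open>boxes\<close>.\<close>

fun seq_sum :: "'v set \<Rightarrow> (nat \<Rightarrow> 'v \<Rightarrow> real) \<Rightarrow> nat \<Rightarrow> ('v list \<Rightarrow> real) \<Rightarrow> real" where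
  "seq_sum U q 0 g = g []"
| "seq_sum U q (Suc n) g = seq_sum U q n (\<lambda>vs. \<Sum>u\<in>U. q (Suc n) u * g (vs @ [u]))"

lemma seq_sum_cong:
  "(\<And>vs. length vs = n \<Longrightarrow> set vs \<subseteq> U \<Longrightarrow> g vs = g' vs) \<Longrightarrow> seq_sum U q n g = seq_sum U q n g'"
proof (induction n arbitrary: g g')
  case (Suc n)
  show ?case
    unfolding seq_sum.simps
    by (rule Suc.IH, rule sum.cong) (use Suc.prems in simp_all)
qed simp

lemma seq_sum_add: "seq_sum U q n (\<lambda>vs. f vs + g vs) = seq_sum U q n f + seq_sum U q n g"
  by (induction n arbitrary: f g) (simp_all add: distrib_left sum.distrib)

lemma seq_sum_cmult: "seq_sum U q n (\<lambda>vs. c * g vs) = c * seq_sum U q n g"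
proof (induction n arbitrary: g)
  case (Suc n)
  then show ?case by (simp add: mult.left_commute flip: sum_distrib_left)
qed simp

lemma seq_sum_zero [simp]: "seq_sum U q n (\<lambda>vs. 0) = 0"
  using seq_sum_cmult[of U q n 0 "\<lambda>_. 0"] by simp

lemma seq_sum_sum: "seq_sum U q n (\<lambda>vs. \<Sum>i\<in>I. g i vs) = (\<Sum>i\<in>I. seq_sum U q n (g i))"
  by (induction I rule: infinite_finite_induct) (simp_all add: seq_sum_add)

text \<open>The product form in which independence delivers the probabilities of words.\<close>

lemma seq_sum_eq_sum_lists:
  assumes "finite U"
  shows "seq_sum U q n g =
    (\<Sum>vs | set vs \<subseteq> U \<and> length vs = n. (\<Prod>i<n. q (Suc i) (vs ! i)) * g vs)"
proof (induction n arbitrary: g)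
  case 0
  have "{vs. set vs \<subseteq> U \<and> vs = []} = {[]}" by auto
  then show ?case by simp
next
  case (Suc n)
  let ?L = "\<lambda>n. {vs. set vs \<subseteq> U \<and> length vs = n}"
  have "seq_sum U q (Suc n) g =
      (\<Sum>vs\<in>?L n. \<Sum>u\<in>U. (\<Prod>i<n. q (Suc i) (vs ! i)) * (q (Suc n) u * g (vs @ [u])))"
    by (simp add: Suc.IH sum_distrib_left)
  also have "\<dots> = (\<Sum>(vs, u)\<in>?L n \<times> U. (\<Prod>i<n. q (Suc i) (vs ! i)) * (q (Suc n) u * g (vs @ [u])))"
    by (rule sum.cartesian_product)
  also have "\<dots> = (\<Sum>vs\<in>?L (Suc n). (\<Prod>i<Suc n. q (Suc i) (vs ! i)) * g vs)"
    by (rule sum.reindex_bij_witness[where i = "\<lambda>vs. (butlast vs, last vs)"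
          and j = "\<lambda>(vs, u). vs @ [u]"])
      (auto simp: nth_append length_Suc_conv_rev)
  finally show ?case .
qed

lemma merge_at_snoc:
  "Suc p < length vs \<Longrightarrow> merge_at f p (vs @ [u]) = merge_at f p vs @ [u]"
  by (simp add: merge_at_def nth_append)

lemma merge_at_snoc2: "merge_at f (length vs) (vs @ [u, w]) = vs @ [f u w]"
  by (simp add: merge_at_def nth_append)

text \<open>By induction on the word length, invariance under merging at a uniform position reduces to the
  single-letter identity \<open>ident\<close>.\<close>

lemma sum_seq_sum_merge_less:
  assumes ident: "\<And>n g. real n * (\<Sum>u\<in>U. q (Suc (Suc n)) u * g u) +
      (\<Sum>u\<in>U. q (Suc n) u * (\<Sum>w\<in>U. q (Suc (Suc n)) w * g (f u w))) =
      real (Suc n) * (\<Sum>u\<in>U. q (Suc n) u * g u)"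
  shows "(\<Sum>p<n. seq_sum U q (Suc n) (\<lambda>vs. g (merge_at f p vs))) = real n * seq_sum U q n g"
proof (induction n arbitrary: g)
  case (Suc n)
  let ?E = "seq_sum U q"
  let ?g = "\<lambda>vs. \<Sum>u\<in>U. q (Suc (Suc n)) u * g (vs @ [u])"
  \<comment> \<open>The last letter is outside the merge. It ends up at place \<open>n + 1\<close>
    but keeps the weight of index \<open>n + 2\<close>, which is the source of the first term of
    \<open>ident\<close>.\<close>
  have 1: "?E (Suc (Suc n)) (\<lambda>vs. g (merge_at f p vs)) = ?E (Suc n) (\<lambda>vs. ?g (merge_at f p vs))"
    if "p < n" for p
    unfolding seq_sum.simps(2)[of U q "Suc n"]
    by (rule seq_sum_cong) (use that in \<open>simp add: merge_at_snoc\<close>)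
  \<comment> \<open>The merge of the last two letters yields the second term of
    \<open>ident\<close>.\<close>
  have 2: "?E (Suc (Suc n)) (\<lambda>vs. g (merge_at f n vs)) =
      ?E n (\<lambda>vs. \<Sum>u\<in>U. q (Suc n) u * (\<Sum>w\<in>U. q (Suc (Suc n)) w * g (vs @ [f u w])))"
    unfolding seq_sum.simps
  proof (rule seq_sum_cong)
    fix vs :: "'a list" assume "length vs = n"
    then have "merge_at f n (vs @ [u, w]) = vs @ [f u w]" for u w
      using merge_at_snoc2[of f vs] by simp
    then show "(\<Sum>u\<in>U. q (Suc n) u * (\<Sum>w\<in>U. q (Suc (Suc n)) w * g (merge_at f n ((vs @ [u]) @ [w])))) =
        (\<Sum>u\<in>U. q (Suc n) u * (\<Sum>w\<in>U. q (Suc (Suc n)) w * g (vs @ [f u w])))"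
      by simp
  qed
  have "(\<Sum>p<Suc n. ?E (Suc (Suc n)) (\<lambda>vs. g (merge_at f p vs))) = 
      real n * ?E n ?g +
      ?E n (\<lambda>vs. \<Sum>u\<in>U. q (Suc n) u * (\<Sum>w\<in>U. q (Suc (Suc n)) w * g (vs @ [f u w])))"
    using Suc.IH[of ?g] 1 2 by (simp del: seq_sum.simps)
  also have "\<dots> = ?E n (\<lambda>vs. real n * ?g vs +
      (\<Sum>u\<in>U. q (Suc n) u * (\<Sum>w\<in>U. q (Suc (Suc n)) w * g (vs @ [f u w]))))"
    by (simp only: seq_sum_add seq_sum_cmult)
  also have "\<dots> = ?E n (\<lambda>vs. real (Suc n) * (\<Sum>u\<in>U. q (Suc n) u * g (vs @ [u])))"
    using ident[of n "\<lambda>u. g (vs @ [u])" for vs] by (intro seq_sum_cong) blast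
  also have "\<dots> = real (Suc n) * ?E (Suc n) g"
    by (simp only: seq_sum_cmult seq_sum.simps)
  finally show ?case .
qed simp

text \<open>The remaining place \<open>p = n\<close> has no right neighbour: the last letter is
  dropped, its weights sum to 1, and one further copy of the expectation results.\<close>

lemma sum_seq_sum_merge:
  assumes "\<And>n g. real n * (\<Sum>u\<in>U. q (Suc (Suc n)) u * g u) +
      (\<Sum>u\<in>U. q (Suc n) u * (\<Sum>w\<in>U. q (Suc (Suc n)) w * g (f u w))) =
      real (Suc n) * (\<Sum>u\<in>U. q (Suc n) u * g u)"
    and one: "\<And>n. (\<Sum>u\<in>U. q (Suc n) u) = 1"
  shows "(\<Sum>p\<le>n. seq_sum U q (Suc n) (\<lambda>vs. g (merge_at f p vs))) = real (Suc n) * seq_sum U q n g"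
proof -
  have "seq_sum U q (Suc n) (\<lambda>vs. g (merge_at f n vs)) = seq_sum U q n g"
    unfolding seq_sum.simps
    by (rule seq_sum_cong) (simp add: merge_at_def one flip: sum_distrib_right)
  with sum_seq_sum_merge_less[where g = g and n = n, OF assms(1)] show ?thesis
    by (simp add: distrib_right lessThan_Suc_atMost[symmetric] del: seq_sum.simps)
qed

section \<open>Sums over permutations by last entry and by position of one entry\<close>

lemma sum_permutations_of_set_snoc:
  assumes "finite A" "A \<noteq> {}"
  shows "(\<Sum>xs\<in>permutations_of_set A. f xs) =
    (\<Sum>x\<in>A. \<Sum>ys\<in>permutations_of_set (A - {x}). f (ys @ [x]))"
proof -
  have "(\<Sum>x\<in>A. \<Sum>ys\<in>permutations_of_set (A - {x}). f (ys @ [x])) =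
     (\<Sum>(x, ys)\<in>(SIGMA x:A. permutations_of_set (A - {x})). f (ys @ [x]))"
    using assms by (intro sum.Sigma) auto
  also have "\<dots> = (\<Sum>xs\<in>permutations_of_set A. f xs)"
  proof (rule sum.reindex_bij_witness[where i = "\<lambda>xs. (last xs, butlast xs)"
          and j = "\<lambda>(x, ys). ys @ [x]"])
    fix xs assume xs: "xs \<in> permutations_of_set A"
    with assms obtain ys y where "xs = ys @ [y]"
      by (cases xs rule: rev_cases) (auto dest: permutations_of_setD)
    with xs show "(last xs, butlast xs) \<in> (SIGMA x:A. permutations_of_set (A - {x}))"
      "(case (last xs, butlast xs) of (x, ys) \<Rightarrow> ys @ [x]) = xs"
      by (auto simp: permutations_of_set_def)
  qed (force simp: permutations_of_set_def)+
  finally show ?thesis by simp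
qed

text \<open>Expresses that in a uniform permutation the position of \<open>z\<close> is uniform and
  independent of the order of the other entries.\<close>

lemma sum_permutations_of_set_insert:
  assumes "finite A" "z \<notin> A"
  shows "(\<Sum>xs\<in>permutations_of_set (insert z A). f xs) =
    (\<Sum>ys\<in>permutations_of_set A. \<Sum>p\<le>card A. f (take p ys @ z # drop p ys))"
proof -
  have "(\<Sum>ys\<in>permutations_of_set A. \<Sum>p\<le>card A. f (take p ys @ z # drop p ys)) =
     (\<Sum>(ys, p)\<in>permutations_of_set A \<times> {..card A}. f (take p ys @ z # drop p ys))"
    by (rule sum.cartesian_product)
  also have "\<dots> = (\<Sum>xs\<in>permutations_of_set (insert z A). f xs)"
  proof (rule sum.reindex_bij_witness[where
        i = "\<lambda>xs. (remove1 z xs, length (takeWhile (\<lambda>y. y \<noteq> z) xs))"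
        and j = "\<lambda>(ys, p). take p ys @ z # drop p ys"])
    fix yp assume yp: "yp \<in> permutations_of_set A \<times> {..card A}"
    obtain ys p where [simp]: "yp = (ys, p)" by force
    have ys: "set ys = A" "distinct ys" "length ys = card A" "p \<le> card A"
      using yp length_finite_permutations_of_set by (auto dest: permutations_of_setD)
    have z: "z \<notin> set (take p ys)" "z \<notin> set (drop p ys)"
      using assms ys by (auto dest: in_set_takeD in_set_dropD)
    let ?xs = "take p ys @ z # drop p ys"
    have "length (takeWhile (\<lambda>y. y \<noteq> z) ?xs) = p"
      using z ys by (subst takeWhile_append2) auto
    moreover have "remove1 z ?xs = ys"
      using z by (simp add: remove1_append)
    ultimately show "(remove1 z (case yp of (ys, p) \<Rightarrow> take p ys @ z # drop p ys),
        length (takeWhile (\<lambda>y. y \<noteq> z) (case yp of (ys, p) \<Rightarrow> take p ys @ z # drop p ys))) = yp"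
      by simp
    have "set (take p ys) \<union> set (drop p ys) = A" "set (take p ys) \<inter> set (drop p ys) = {}"
      using ys by (metis append_take_drop_id set_append, metis append_take_drop_id distinct_append)
    then show "(case yp of (ys, p) \<Rightarrow> take p ys @ z # drop p ys) \<in> permutations_of_set (insert z A)"
      using z ys by (auto simp: permutations_of_set_def)
  next
    fix xs assume "xs \<in> permutations_of_set (insert z A)"
    then have xs: "distinct xs" "set xs = insert z A" by (auto dest: permutations_of_setD)
    then obtain us ws where us: "xs = us @ z # ws" by (metis insertI1 split_list)
    with xs have z: "z \<notin> set us" "z \<notin> set ws" by auto
    have A: "A = set us \<union> set ws" using xs us z assms by auto
    have "takeWhile (\<lambda>y. y \<noteq> z) xs = us"
      using z us by (subst us, subst takeWhile_append2) auto
    moreover have "remove1 z xs = us @ ws" using z us by (simp add: remove1_append)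
    moreover have "card A = length us + length ws"
      using distinct_card[of "us @ ws"] xs us A by auto
    ultimately show "(remove1 z xs, length (takeWhile (\<lambda>y. y \<noteq> z) xs)) \<in> permutations_of_set A \<times> {..card A}"
      "(case (remove1 z xs, length (takeWhile (\<lambda>y. y \<noteq> z) xs)) of (ys, p) \<Rightarrow> take p ys @ z # drop p ys) = xs"
      using xs us A by (auto simp: permutations_of_set_def)
  qed auto
  finally show ?thesis by simp
qed

section \<open>The Ewens law\<close>

lemma sum_card_partition_on:
  assumes "finite A" "partition_on A P"
  shows "(\<Sum>B\<in>P. card B) = card A"
proof -
  have "card (\<Union>P) = (\<Sum>B\<in>P. card B)"
    using assms by (intro card_Union_disjoint)
      (auto simp: partition_on_def disjoint_def pairwise_def disjnt_def intro: finite_subset)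
  with assms show ?thesis by (simp add: partition_on_def)
qed

lemma sum_UNIV_bool: "(\<Sum>u\<in>UNIV. f u) = f True + f False"
  by (simp add: UNIV_bool add.commute)

text \<open>The induction removes the last ball. It needs the joint law of the partition and the last
  box: given the partition, the last box is a size-biased pick.\<close>

lemma sum_boxes_hd:
  fixes \<theta> :: real and q :: "nat \<Rightarrow> bool \<Rightarrow> real"
  assumes \<theta>: "0 \<le> \<theta>"
    and q1: "q 1 True = 1" "q 1 False = 0"
    and q: "\<And>n. 1 \<le> n \<Longrightarrow> q (Suc n) True = \<theta> / (\<theta> + real n)"
      "\<And>n. 1 \<le> n \<Longrightarrow> q (Suc n) False = real n / (\<theta> + real n)"
    and A: "card A = Suc n" "partition_on A P" "B \<in> P"
  shows "(\<Sum>xs\<in>permutations_of_set A. seq_sum UNIV q (Suc n)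
      (\<lambda>bs. of_bool (set (boxes xs bs) = P \<and> hd (boxes xs bs) = B))) =
    \<theta> ^ (card P - 1) / pochhammer (\<theta> + 1) n * fact n * real (card B) * (\<Prod>C\<in>P. fact (card C - 1))"
  using A
proof (induction n arbitrary: A P B)
  case 0
  then obtain a where [simp]: "A = {a}" by (metis One_nat_def card_1_singletonE)
  have "\<Union>P = {a}" "{} \<notin> P" using 0 by (auto simp: partition_on_def)
  then have "P \<subseteq> {{a}}" by (metis Sup_upper singletonI subsetI subset_singletonD)
  with \<open>B \<in> P\<close> have P: "P = {{a}}" "B = {a}" by auto
  with q1 show ?case by (simp add: UNIV_bool)
next
  case (Suc n)
  have fin: "finite A" using Suc.prems(1) by (metis card.infinite nat.distinct(1))
  have B: "B \<subseteq> A" "B \<noteq> {}" "finite B"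
    using Suc.prems fin by (auto simp: partition_on_def intro: finite_subset)
  have finP: "finite P" using fin Suc.prems(2) by (rule finite_elements)
  have disj: "B \<inter> C = {}" if "C \<in> P" "C \<noteq> B" for C
    using that Suc.prems by (auto simp: partition_on_def disjoint_def)
  have PD: "\<Union>P = A" "\<And>C. C \<in> P \<Longrightarrow> C \<noteq> {}" "\<And>C D. C \<in> P \<Longrightarrow> D \<in> P \<Longrightarrow> C \<noteq> D \<Longrightarrow> C \<inter> D = {}"
    using Suc.prems(2) by (auto simp: partition_on_def disjoint_def)
  have Un: "\<Union>(P - {B}) = A - B"
    using disj Suc.prems(3) unfolding PD(1)[symmetric] by blast
  let ?E = "seq_sum UNIV q"
  let ?s = "\<theta> + real (Suc n)"
  let ?q = "q (Suc (Suc n))"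
  have qT: "?q True = \<theta> / ?s" and qF: "?q False = real (Suc n) / ?s"
    using q[of "Suc n"] by auto
  have poch: "pochhammer (\<theta> + 1) (Suc n) = pochhammer (\<theta> + 1) n * ?s"
    by (simp add: pochhammer_Suc add_ac)
  define W where "W = (\<Sum>xs\<in>permutations_of_set A. ?E (Suc (Suc n))
      (\<lambda>bs. of_bool (set (boxes xs bs) = P \<and> hd (boxes xs bs) = B)))"
  let ?last = "\<lambda>x ys bs. \<Sum>u\<in>UNIV. ?q u * of_bool (set (add_ball (boxes ys bs) (x, u)) = P \<and>
          hd (add_ball (boxes ys bs) (x, u)) = B)"
  have len: "length ys = Suc n" if "x \<in> A" "ys \<in> permutations_of_set (A - {x})" for x ys
    using that fin Suc.prems(1) length_finite_permutations_of_set[OF that(2)] by simp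
  have W: "W = (\<Sum>x\<in>A. \<Sum>ys\<in>permutations_of_set (A - {x}). ?E (Suc n) (?last x ys))"
    unfolding W_def seq_sum.simps(2)[of _ _ "Suc n"]
    using fin B
    by (subst sum_permutations_of_set_snoc)
      (auto intro!: sum.cong seq_sum_cong simp: len simp del: seq_sum.simps)
  have box: "\<exists>C Cs. boxes ys bs = C # Cs \<and> distinct (C # Cs) \<and> C \<noteq> {} \<and> x \<notin> C \<and>
      (\<forall>D\<in>set Cs. x \<notin> D)"
    if "x \<in> A" "ys \<in> permutations_of_set (A - {x})" "length bs = Suc n" for x ys bs
  proof -
    have ys: "set ys = A - {x}" "distinct ys" "length bs = length ys"
      using that len[OF that(1,2)] by (auto dest: permutations_of_setD)
    have p: "partition_on (A - {x}) (set (boxes ys bs))" "distinct (boxes ys bs)"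
      using boxes_partition[OF ys(3,2)] ys(1) by auto
    have "A - {x} \<noteq> {}" using ys(1,3) that(3) by (metis list.size(3) nat.distinct(1) set_empty)
    with p have "boxes ys bs \<noteq> []" by (auto simp: partition_on_def)
    with p show ?thesis
      by (cases "boxes ys bs") (auto simp: partition_on_def)
  qed
  show ?case
  proof (cases "card B = 1")
    case True
    then obtain y where y: "B = {y}" by (auto simp: card_1_singleton_iff)
    let ?P = "P - {B}"
    have P': "partition_on (A - {y}) ?P"
      using PD Un unfolding y by (intro partition_onI) (auto simp: disjnt_def)
    have card': "card (A - {y}) = Suc n" using B y Suc.prems(1) by simp
    have "?last x ys bs = (if x = y then ?q True *
        (\<Sum>B'\<in>?P. of_bool (set (boxes ys bs) = ?P \<and> hd (boxes ys bs) = B')) else 0)"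
      if x: "x \<in> A" "ys \<in> permutations_of_set (A - {x})" "length bs = Suc n" for x ys bs
    proof -
      obtain C Cs where C: "boxes ys bs = C # Cs" "C \<noteq> {}" "x \<notin> C" "\<forall>D\<in>set Cs. x \<notin> D"
        using box[OF x] by blast
      \<comment> \<open>A letter 0 would put the ball into a nonempty box, so a singleton last box
        forces the letter 1.\<close>
      have "insert x C \<noteq> {y}" using C by auto
      then have F: "\<not> hd (add_ball (boxes ys bs) (x, False)) = B" by (simp add: C y)
      have "insert {x} (insert C (set Cs)) = P \<and> {x} = B \<longleftrightarrow> x = y \<and> insert C (set Cs) = ?P"
        using C Suc.prems(3) unfolding y by blast
      then have T: "(set (add_ball (boxes ys bs) (x, True)) = P \<and>
          hd (add_ball (boxes ys bs) (x, True)) = B) \<longleftrightarrow> x = y \<and> set (boxes ys bs) = ?P"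
        by (simp add: C)
      \<comment> \<open>\<open>P\<close> does not determine the previous last box, so its possible
        values are summed over in order to reach the induction hypothesis.\<close>
      have "(\<Sum>B'\<in>?P. of_bool (set (boxes ys bs) = ?P \<and> hd (boxes ys bs) = B') :: real) =
          of_bool (set (boxes ys bs) = ?P)"
      proof (cases "set (boxes ys bs) = ?P")
        case True
        then have "C \<in> ?P" by (simp add: C flip: True)
        have "(\<Sum>B'\<in>?P. of_bool (set (boxes ys bs) = ?P \<and> hd (boxes ys bs) = B') :: real) =
            (\<Sum>B'\<in>?P. if C = B' then 1 else 0)"
          using True C(1) by (intro sum.cong refl) (simp only: of_bool_def list.sel simp_thms)
        with \<open>C \<in> ?P\<close> finP True show ?thesis by simp
      qed simp
      then show ?thesis
        unfolding sum_UNIV_bool using F T by (simp del: add_ball_True)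
    qed
    then have "W = (\<Sum>x\<in>A. \<Sum>ys\<in>permutations_of_set (A - {x}). ?E (Suc n) (\<lambda>bs. if x = y then ?q True *
        (\<Sum>B'\<in>?P. of_bool (set (boxes ys bs) = ?P \<and> hd (boxes ys bs) = B')) else 0))"
      unfolding W by (intro sum.cong refl seq_sum_cong)
    also have "\<dots> = (\<Sum>x\<in>A. if x = y then \<Sum>ys\<in>permutations_of_set (A - {x}). ?E (Suc n) (\<lambda>bs. ?q True *
        (\<Sum>B'\<in>?P. of_bool (set (boxes ys bs) = ?P \<and> hd (boxes ys bs) = B'))) else 0)"
      by (intro sum.cong refl) (simp del: seq_sum.simps)
    also have "\<dots> = (\<Sum>ys\<in>permutations_of_set (A - {y}). ?E (Suc n) (\<lambda>bs. ?q True *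
        (\<Sum>B'\<in>?P. of_bool (set (boxes ys bs) = ?P \<and> hd (boxes ys bs) = B'))))"
      using B y fin by (simp del: seq_sum.simps)
    also have "\<dots> = ?q True * (\<Sum>ys\<in>permutations_of_set (A - {y}). \<Sum>B'\<in>?P.
        ?E (Suc n) (\<lambda>bs. of_bool (set (boxes ys bs) = ?P \<and> hd (boxes ys bs) = B')))"
      by (simp only: seq_sum_cmult seq_sum_sum sum_distrib_left)
    also have "(\<Sum>ys\<in>permutations_of_set (A - {y}). \<Sum>B'\<in>?P.
        ?E (Suc n) (\<lambda>bs. of_bool (set (boxes ys bs) = ?P \<and> hd (boxes ys bs) = B'))) =
      (\<Sum>B'\<in>?P. \<theta> ^ (card ?P - 1) / pochhammer (\<theta> + 1) n * fact n * real (card B') *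
         (\<Prod>C\<in>?P. fact (card C - 1)))"
      by (subst sum.swap) (intro sum.cong refl Suc.IH card' P')
    also have "\<dots> = \<theta> ^ (card ?P - 1) / pochhammer (\<theta> + 1) n * fact n * (\<Prod>C\<in>?P. fact (card C - 1)) *
         real (\<Sum>B'\<in>?P. card B')"
      unfolding of_nat_sum sum_distrib_left by (intro sum.cong) (simp_all add: mult_ac)
    \<comment> \<open>The size-biased weights of the possible previous boxes add up to the number of
      remaining balls, which cancels the unknown box.\<close>
    also have "(\<Sum>B'\<in>?P. card B') = Suc n"
      using sum_card_partition_on[OF _ P'] fin card' by simp
    also have "(\<Prod>C\<in>?P. fact (card C - 1)) = (\<Prod>C\<in>P. fact (card C - 1) :: real)"
      using Suc.prems(3) finP True by (subst prod.remove[of P B]) auto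
    finally have W': "W = ?q True * (\<theta> ^ (card ?P - 1) / pochhammer (\<theta> + 1) n * fact n *
        (\<Prod>C\<in>P. fact (card C - 1)) * real (Suc n))" .
    \<comment> \<open>Guards the truncated subtraction: since another block exists, the exponent of
      \<theta> really drops by one.\<close>
    have "?P \<noteq> {}"
      using Un card' y by (metis Union_empty card.empty nat.distinct(1))
    then have "card ?P > 0" using finP by (simp add: card_gt_0_iff)
    moreover have "card P = Suc (card ?P)" using finP Suc.prems(3) by (metis card.remove)
    ultimately have "\<theta> ^ (card P - 1) = \<theta> * \<theta> ^ (card ?P - 1)"
      by (simp flip: power_Suc)
    then show ?thesis
      unfolding W_def[symmetric] W' qT poch True fact_Suc
      by (simp only: times_divide_eq_right times_divide_eq_left divide_divide_eq_left
          of_nat_1 mult_1_right mult_ac)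
  next
    case False
    with B have cardB: "card B \<ge> 2"
      by (cases "card B") auto
    \<comment> \<open>The partition before the last ball \<open>x\<close> was added to
      \<open>B\<close> by a letter 0. As \<open>B\<close> has at least two balls,
      \<open>B - {x}\<close> is a genuine block.\<close>
    let ?P = "\<lambda>x. insert (B - {x}) (P - {B})"
    have ne: "B - {x} \<noteq> {}" for x
      using card_mono[of "{x}" B] cardB by auto
    have nin: "B - {x} \<notin> P - {B}" for x
      using ne[of x] disj[of "B - {x}"] by auto
    have P': "partition_on (A - {x}) (?P x)" if "x \<in> B" for x
    proof (rule partition_onI)
      show "\<Union>(?P x) = A - {x}" using Un that B by auto
      show "{} \<notin> ?P x" using ne[of x] PD(2) by blast
      show "disjnt C D" if "C \<in> ?P x" "D \<in> ?P x" "C \<noteq> D" for C D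
      proof -
        have "disjnt (B - {x}) D" if "D \<in> P - {B}" for D
          using disj that by (auto simp: disjnt_def)
        with that PD(3) show ?thesis by (auto simp: disjnt_def)
      qed
    qed
    have card': "card (A - {x}) = Suc n" if "x \<in> B" for x using B that Suc.prems(1) by auto
    have "?last x ys bs = (if x \<in> B then ?q False *
        of_bool (set (boxes ys bs) = ?P x \<and> hd (boxes ys bs) = B - {x}) else 0)"
      if x: "x \<in> A" "ys \<in> permutations_of_set (A - {x})" "length bs = Suc n" for x ys bs
    proof -
      obtain C Cs where C: "boxes ys bs = C # Cs" "C \<noteq> {}" "x \<notin> C" "\<forall>D\<in>set Cs. x \<notin> D" "C \<notin> set Cs"
        using box[OF x] by auto
      have T: "\<not> hd (add_ball (boxes ys bs) (x, True)) = B"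
        using ne[of x] by auto
      have "insert (insert x C) (set Cs) = P \<and> insert x C = B \<longleftrightarrow>
          x \<in> B \<and> insert C (set Cs) = ?P x \<and> C = B - {x}"
      proof
        assume L: "insert (insert x C) (set Cs) = P \<and> insert x C = B"
        moreover have "insert x C \<notin> set Cs" using C by blast
        ultimately have "set Cs = P - {B}" "C = B - {x}" "x \<in> B" using C by auto
        then show "x \<in> B \<and> insert C (set Cs) = ?P x \<and> C = B - {x}" by simp
      next
        assume R: "x \<in> B \<and> insert C (set Cs) = ?P x \<and> C = B - {x}"
        with C(5) nin[of x] have "set Cs = P - {B}" by (metis insert_ident)
        moreover have "insert x C = B" using R by auto
        ultimately show "insert (insert x C) (set Cs) = P \<and> insert x C = B"
          using Suc.prems(3) by auto
      qed
      then have F: "(set (add_ball (boxes ys bs) (x, False)) = P \<and>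
          hd (add_ball (boxes ys bs) (x, False)) = B) \<longleftrightarrow>
          x \<in> B \<and> set (boxes ys bs) = ?P x \<and> hd (boxes ys bs) = B - {x}"
        by (simp add: C)
      show ?thesis
        unfolding sum_UNIV_bool using F T by (simp del: add_ball_True)
    qed
    then have "W = (\<Sum>x\<in>A. \<Sum>ys\<in>permutations_of_set (A - {x}). ?E (Suc n) (\<lambda>bs. if x \<in> B then ?q False *
        of_bool (set (boxes ys bs) = ?P x \<and> hd (boxes ys bs) = B - {x}) else 0))"
      unfolding W by (intro sum.cong refl seq_sum_cong)
    also have "\<dots> = (\<Sum>x\<in>A. if x \<in> B then \<Sum>ys\<in>permutations_of_set (A - {x}). ?E (Suc n) (\<lambda>bs. ?q False *
        of_bool (set (boxes ys bs) = ?P x \<and> hd (boxes ys bs) = B - {x})) else 0)"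
      by (intro sum.cong refl) (simp del: seq_sum.simps)
    also have "\<dots> = (\<Sum>x\<in>B. \<Sum>ys\<in>permutations_of_set (A - {x}). ?E (Suc n) (\<lambda>bs. ?q False *
        of_bool (set (boxes ys bs) = ?P x \<and> hd (boxes ys bs) = B - {x})))"
      using B fin by (simp add: sum.If_cases Int_absorb1 del: seq_sum.simps)
    also have "\<dots> = (\<Sum>x\<in>B. ?q False * (\<Sum>ys\<in>permutations_of_set (A - {x}).
        ?E (Suc n) (\<lambda>bs. of_bool (set (boxes ys bs) = ?P x \<and> hd (boxes ys bs) = B - {x}))))"
      by (simp only: seq_sum_cmult sum_distrib_left)
    also have "\<dots> = (\<Sum>x\<in>B. ?q False * (\<theta> ^ (card (?P x) - 1) / pochhammer (\<theta> + 1) n * fact n *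
        real (card (B - {x})) * (\<Prod>C\<in>?P x. fact (card C - 1))))"
      by (intro sum.cong refl arg_cong2[where f = "(*)"] Suc.IH card' P') auto
    also have "\<dots> = (\<Sum>x\<in>B. ?q False * (\<theta> ^ (card P - 1) / pochhammer (\<theta> + 1) n * fact n *
        (\<Prod>C\<in>P. fact (card C - 1))))"
    proof (rule sum.cong[OF refl])
      fix x assume x: "x \<in> B"
      have cx: "card (B - {x}) = card B - 1" using x B by simp
      have cP: "card (?P x) = card P"
        using nin[of x] finP card.remove[OF finP Suc.prems(3)] by simp
      obtain m where m: "card B = Suc (Suc m)"
        using le_Suc_ex[OF cardB] by auto
      \<comment> \<open>The size-bias factor \<open>card B - 1\<close> of the shrunken block turns
        \<open>fact (card B - 2)\<close> into \<open>fact (card B - 1)\<close>.\<close>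
      have "(\<Prod>C\<in>?P x. fact (card C - 1)) = fact (card B - 2) * (\<Prod>C\<in>P - {B}. fact (card C - 1) :: real)"
        using nin[of x] finP cx by (simp add: numeral_2_eq_2)
      moreover have "(\<Prod>C\<in>P. fact (card C - 1)) = fact (card B - 1) * (\<Prod>C\<in>P - {B}. fact (card C - 1) :: real)"
        using finP Suc.prems(3) by (rule prod.remove)
      ultimately have "real (card (B - {x})) * (\<Prod>C\<in>?P x. fact (card C - 1)) = (\<Prod>C\<in>P. fact (card C - 1))"
        by (simp add: cx m)
      then show "?q False * (\<theta> ^ (card (?P x) - 1) / pochhammer (\<theta> + 1) n * fact n *
          real (card (B - {x})) * (\<Prod>C\<in>?P x. fact (card C - 1))) =
        ?q False * (\<theta> ^ (card P - 1) / pochhammer (\<theta> + 1) n * fact n * (\<Prod>C\<in>P. fact (card C - 1)))"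
        unfolding cP by (simp only: mult.assoc)
    qed
    \<comment> \<open>The summand no longer depends on \<open>x\<close>. The new factor
      \<open>card B\<close> counts which ball of \<open>B\<close> came last.\<close>
    finally have W': "W = real (card B) * (?q False * (\<theta> ^ (card P - 1) / pochhammer (\<theta> + 1) n * fact n *
        (\<Prod>C\<in>P. fact (card C - 1))))" by simp
    show ?thesis
      unfolding W_def[symmetric] W' qF poch fact_Suc
      by (simp only: times_divide_eq_right times_divide_eq_left divide_divide_eq_left
          of_nat_1 mult_1_right mult_ac)
  qed
qed

text \<open>Summing the joint law over the last box: the block sizes add up to \<open>n\<close>,
  which raises \<open>fact (n - 1)\<close> to \<open>fact n\<close>.\<close>

lemma sum_boxes_eq_ewens:
  fixes \<theta> :: real and q :: "nat \<Rightarrow> bool \<Rightarrow> real"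
  assumes "0 \<le> \<theta>"
    and "q 1 True = 1" "q 1 False = 0"
    and "\<And>n. 1 \<le> n \<Longrightarrow> q (Suc n) True = \<theta> / (\<theta> + real n)"
      "\<And>n. 1 \<le> n \<Longrightarrow> q (Suc n) False = real n / (\<theta> + real n)"
    and A: "card A = n" "1 \<le> n" "partition_on A P"
  shows "(\<Sum>xs\<in>permutations_of_set A. seq_sum UNIV q n (\<lambda>bs. of_bool (set (boxes xs bs) = P))) =
    fact n * (\<theta> ^ (card P - 1) / pochhammer (\<theta> + 1) (n - 1) * (\<Prod>C\<in>P. fact (card C - 1)))"
proof -
  obtain m where m: "n = Suc m" using A by (metis Suc_le_D One_nat_def)
  have fin: "finite A" using A m by (metis card.infinite nat.distinct(1))
  have finP: "finite P" using fin A(3) by (rule finite_elements)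
  let ?K = "\<theta> ^ (card P - 1) / pochhammer (\<theta> + 1) m * fact m"
  have "seq_sum UNIV q n (\<lambda>bs. of_bool (set (boxes xs bs) = P)) =
      (\<Sum>B\<in>P. seq_sum UNIV q (Suc m) (\<lambda>bs. of_bool (set (boxes xs bs) = P \<and> hd (boxes xs bs) = B)))"
    if "xs \<in> permutations_of_set A" for xs
    unfolding m seq_sum_sum[symmetric]
  proof (rule seq_sum_cong)
    fix bs :: "bool list" assume "length bs = Suc m"
    with that m A have "length bs = length xs" "set xs = A"
      by (auto simp: length_finite_permutations_of_set dest: permutations_of_setD)
    moreover have "A \<noteq> {}" using A m by auto
    ultimately have ne: "boxes xs bs \<noteq> []"
      using boxes_partition(2)[of bs xs] that
      by (auto simp: partition_on_def dest: permutations_of_setD)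
    show "of_bool (set (boxes xs bs) = P) =
        (\<Sum>B\<in>P. of_bool (set (boxes xs bs) = P \<and> hd (boxes xs bs) = B) :: real)"
    proof (cases "set (boxes xs bs) = P")
      case True
      then have "hd (boxes xs bs) \<in> P" using ne hd_in_set by blast
      with True finP show ?thesis by (simp add: of_bool_def)
    qed simp
  qed
  then have "(\<Sum>xs\<in>permutations_of_set A. seq_sum UNIV q n (\<lambda>bs. of_bool (set (boxes xs bs) = P))) =
    (\<Sum>B\<in>P. \<Sum>xs\<in>permutations_of_set A. seq_sum UNIV q (Suc m)
      (\<lambda>bs. of_bool (set (boxes xs bs) = P \<and> hd (boxes xs bs) = B)))"
    by (subst sum.swap) (rule sum.cong[OF refl])
  also have "\<dots> = (\<Sum>B\<in>P. ?K * real (card B) * (\<Prod>C\<in>P. fact (card C - 1)))"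
    using A m by (intro sum.cong refl sum_boxes_hd assms) auto
  also have "\<dots> = ?K * (\<Prod>C\<in>P. fact (card C - 1)) * real (\<Sum>B\<in>P. card B)"
    unfolding of_nat_sum sum_distrib_left by (intro sum.cong) (simp_all add: mult_ac)
  also have "(\<Sum>B\<in>P. card B) = n" using sum_card_partition_on[OF fin A(3)] A by simp
  finally show ?thesis by (simp add: m mult_ac)
qed

section \<open>The law of the letters and the permutation\<close>

lemma threshold_set_borel: "{x::real. map (\<lambda>t. x \<le> t) ts = v} \<in> sets borel"
proof (induction ts arbitrary: v)
  case (Cons t ts)
  show ?case
  proof (cases v)
    case (Cons b w)
    have "{x. (x \<le> t) = b} = (if b then {..t} else {t<..})" by auto
    then have "{x. (x \<le> t) = b} \<in> sets borel" by simp
    moreover have "{x. map (\<lambda>t. x \<le> t) (t # ts) = v} =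
        {x. (x \<le> t) = b} \<inter> {x. map (\<lambda>t. x \<le> t) ts = w}"
      using Cons by auto
    ultimately show ?thesis using Cons.IH[of w] by simp
  qed simp
qed simp

text \<open>Meant for a difference of laws, hence additive but of no fixed sign. Threshold events
  arise from half-lines by finitely many intersections and complements, so finite additivity is
  enough. Only half-lines with nonnegative end occur, as the distribution functions are prescribed
  only there.\<close>

lemma additive_zero_on_threshold_sets:
  fixes \<phi> :: "real set \<Rightarrow> real"
  assumes add: "\<And>E F. E \<in> sets borel \<Longrightarrow> F \<in> sets borel \<Longrightarrow> E \<inter> F = {} \<Longrightarrow> \<phi> (E \<union> F) = \<phi> E + \<phi> F"
    and UNIV: "\<phi> UNIV = 0" and le: "\<And>a. 0 \<le> a \<Longrightarrow> \<phi> {..a} = 0"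
    and ts: "list_all (\<lambda>t. 0 \<le> t) ts"
  shows "\<phi> {x. map (\<lambda>t. x \<le> t) ts = v} = 0"
proof -
  let ?E = "\<lambda>ts v. {x::real. map (\<lambda>t. x \<le> t) ts = v}"
  \<comment> \<open>Strengthened by an intersection with a half-line, because each further time
    intersects with one or removes one.\<close>
  have "\<phi> (?E ts v) = 0 \<and> (\<forall>a\<ge>0. \<phi> (?E ts v \<inter> {..a}) = 0)"
    using ts
  proof (induction ts arbitrary: v)
    case Nil
    have "\<phi> {} = 0" using add[of "{}" "{}"] by simp
    then show ?case using UNIV le by (cases v) auto
  next
    case (Cons t ts)
    have t: "0 \<le> t" using Cons.prems by simp
    show ?case
    proof (cases v)
      case Nil
      have "\<phi> {} = 0" using add[of "{}" "{}"] by simp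
      with Nil show ?thesis by simp
    next
      case (Cons b w)
      let ?F = "?E ts w"
      have F: "?F \<in> sets borel" "\<phi> ?F = 0" "\<And>a. 0 \<le> a \<Longrightarrow> \<phi> (?F \<inter> {..a}) = 0"
        using Cons.IH[of w] Cons.prems threshold_set_borel by auto
      have diff: "\<phi> (G - G \<inter> {..t}) = \<phi> G - \<phi> (G \<inter> {..t})" if "G \<in> sets borel" for G
      proof -
        have "(G - G \<inter> {..t}) \<union> (G \<inter> {..t}) = G" "(G - G \<inter> {..t}) \<inter> (G \<inter> {..t}) = {}"
          by blast+
        with add[of "G - G \<inter> {..t}" "G \<inter> {..t}"] that show ?thesis by simp
      qed
      show ?thesis
      proof (cases b)
        case True
        then have E: "?E (t # ts) v = ?F \<inter> {..t}" using Cons by auto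
        have "?F \<inter> {..t} \<inter> {..a} = ?F \<inter> {..min t a}" for a by auto
        then show ?thesis unfolding E using F t by auto
      next
        case False
        then have E: "?E (t # ts) v = ?F - ?F \<inter> {..t}" using Cons by auto
        have "\<phi> ((?F - ?F \<inter> {..t}) \<inter> {..a}) = 0" if "0 \<le> a" for a
        proof -
          have "(?F - ?F \<inter> {..t}) \<inter> {..a} = ?F \<inter> {..a} - ?F \<inter> {..a} \<inter> {..t}" by auto
          moreover have "?F \<inter> {..a} \<inter> {..t} = ?F \<inter> {..min a t}" by auto
          ultimately show ?thesis
            using diff[of "?F \<inter> {..a}"] F that t by auto
        qed
        then show ?thesis unfolding E using F t diff[of ?F] by auto
      qed
    qed
  qed
  then show ?thesis by blast
qed

text \<open>Injective because a permutation is the identity outside \<open>{1..n}\<close>;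
  surjective because both sides have \<open>fact n\<close> elements.\<close>

lemma bij_betw_permutes_permutations_of_set:
  "bij_betw (\<lambda>\<tau>. map \<tau> [1..<Suc n]) {\<tau>. \<tau> permutes {1..n}} (permutations_of_set {1..n})"
proof -
  let ?f = "\<lambda>\<tau> :: nat \<Rightarrow> nat. map \<tau> [1..<Suc n]" and ?S = "{\<tau>. \<tau> permutes {1..n}}"
  have inj: "inj_on ?f ?S"
  proof (rule inj_onI)
    fix \<sigma> \<tau> assume p: "\<sigma> \<in> ?S" "\<tau> \<in> ?S" and eq: "?f \<sigma> = ?f \<tau>"
    have "\<sigma> i = \<tau> i" for i
    proof (cases "i \<in> {1..n}")
      case True
      then have "i \<in> set [1..<Suc n]" by auto
      with eq show ?thesis by (metis map_eq_conv)
    next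
      case False
      with p show ?thesis by (simp add: permutes_not_in)
    qed
    then show "\<sigma> = \<tau>" by auto
  qed
  have sub: "?f ` ?S \<subseteq> permutations_of_set {1..n}"
  proof (rule image_subsetI)
    fix \<tau> assume "\<tau> \<in> ?S"
    then have \<tau>: "\<tau> permutes {1..n}" by simp
    have "{1..<Suc n} = {1..n}" by auto
    with \<tau> show "?f \<tau> \<in> permutations_of_set {1..n}"
      by (auto simp: permutations_of_set_def distinct_map permutes_inj_on permutes_image
          simp del: upt_Suc)
  qed
  have "card (?f ` ?S) = fact n"
    using inj by (simp add: card_image card_permutations del: upt_Suc)
  with sub have "?f ` ?S = permutations_of_set {1..n}"
    by (intro card_subset_eq) (auto simp del: upt_Suc)
  with inj show ?thesis by (simp add: bij_betw_def)
qed

lemma map_upt_eq_iff: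
  "length vs = n \<Longrightarrow> map f [1..<Suc n] = vs \<longleftrightarrow> (\<forall>j\<in>{1..n}. f j = vs ! (j - 1))"
proof -
  assume n: "length vs = n"
  have "map f [1..<Suc n] = vs \<longleftrightarrow> (\<forall>k<n. f (Suc k) = vs ! k)"
    using n by (auto simp: list_eq_iff_nth_eq simp del: upt_Suc)
  also have "\<dots> \<longleftrightarrow> (\<forall>j\<in>{1..n}. f j = vs ! (j - 1))"
    by (metis One_nat_def Suc_le_eq Suc_pred atLeastAtMost_iff diff_Suc_1 le0 less_Suc_eq_le not_less_eq)
  finally show ?thesis .
qed

section \<open>The probability model and its reduction to finite sums\<close>

locale ewens_coupling = prob_space M for M :: "'a measure" +
  fixes \<Theta> :: "nat \<Rightarrow> 'a \<Rightarrow> real" and \<sigma> :: "nat \<Rightarrow> 'a \<Rightarrow> nat \<Rightarrow> nat"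
  assumes \<Theta>_measurable: "1 \<le> j \<Longrightarrow> \<Theta> j \<in> borel_measurable M"
    and \<Theta>_indep: "indep_vars (\<lambda>_. borel) \<Theta> {1..}"
    and \<Theta>_cdf: "1 \<le> j \<Longrightarrow> 0 \<le> \<theta> \<Longrightarrow> prob {\<omega> \<in> space M. \<Theta> j \<omega> \<le> \<theta>} = Theta_cdf j \<theta>"
    and \<sigma>_permutes: "\<omega> \<in> space M \<Longrightarrow> \<sigma> n \<omega> permutes {1..n}"
    and \<sigma>_uniform: "\<tau> permutes {1..n} \<Longrightarrow> prob {\<omega> \<in> space M. \<sigma> n \<omega> = \<tau>} = 1 / fact n"
    and \<sigma>_\<Theta>_indep: "indep_set {\<sigma> n -` A \<inter> space M | A. True}
      {(\<lambda>\<omega>. restrict (\<lambda>j. \<Theta> j \<omega>) {1..}) -` A \<inter> space M | A. A \<in> sets (PiM {1..} (\<lambda>_. borel))}"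
begin

lemma \<Theta>_event: "1 \<le> j \<Longrightarrow> E \<in> sets borel \<Longrightarrow> {\<omega> \<in> space M. \<Theta> j \<omega> \<in> E} \<in> events"
  using measurable_sets[OF \<Theta>_measurable, of j E] by (simp add: vimage_def Int_def conj_commute)

lemma \<Theta>_prod:
  assumes "J \<noteq> {}" "finite J" "J \<subseteq> {1..}" "\<And>j. j \<in> J \<Longrightarrow> E j \<in> sets borel"
  shows "prob {\<omega> \<in> space M. \<forall>j\<in>J. \<Theta> j \<omega> \<in> E j} = (\<Prod>j\<in>J. prob {\<omega> \<in> space M. \<Theta> j \<omega> \<in> E j})"
proof -
  have "prob (\<Inter>j\<in>J. \<Theta> j -` E j \<inter> space M) = (\<Prod>j\<in>J. prob (\<Theta> j -` E j \<inter> space M))"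
    using assms by (intro indep_varsD[OF \<Theta>_indep]) auto
  moreover have "(\<Inter>j\<in>J. \<Theta> j -` E j \<inter> space M) = {\<omega> \<in> space M. \<forall>j\<in>J. \<Theta> j \<omega> \<in> E j}"
    using assms(1) by auto
  moreover have "\<Theta> j -` E j \<inter> space M = {\<omega> \<in> space M. \<Theta> j \<omega> \<in> E j}" for j by auto
  ultimately show ?thesis by simp
qed

lemma atom_event_prob:
  fixes h :: "real \<Rightarrow> 'v"
  assumes n: "1 \<le> n" and h: "\<And>v. {x. h x = v} \<in> sets borel"
    and \<tau>: "\<tau> permutes {1..n}" and vs: "length vs = n"
  defines "A \<equiv> {\<omega> \<in> space M. \<sigma> n \<omega> = \<tau> \<and> map (\<lambda>j. h (\<Theta> j \<omega>)) [1..<Suc n] = vs}"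
  shows "A \<in> events"
    and "prob A = 1 / fact n * (\<Prod>i<n. prob {\<omega> \<in> space M. h (\<Theta> (Suc i) \<omega>) = vs ! i})"
proof -
  let ?PM = "PiM {1..} (\<lambda>_. borel) :: (nat \<Rightarrow> real) measure"
  let ?E = "\<lambda>j. {x. h x = vs ! (j - 1)}"
  let ?B = "{\<omega> \<in> space M. \<forall>j\<in>{1..n}. \<Theta> j \<omega> \<in> ?E j}"
  \<comment> \<open>The independence assumption concerns the whole threshold sequence, so the event
    on the letters is written as the preimage of a cylinder set.\<close>
  define D where "D = (\<Inter>j\<in>{1..n}. (\<lambda>f. f j) -` ?E j \<inter> space ?PM)"
  have D: "D \<in> sets ?PM"
    unfolding D_def using n h
    by (intro sets.finite_INT measurable_sets[OF measurable_component_singleton]) auto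
  have B: "(\<lambda>\<omega>. restrict (\<lambda>j. \<Theta> j \<omega>) {1..}) -` D \<inter> space M = ?B"
    using n by (auto simp: D_def space_PiM)
  have A: "A = (\<sigma> n -` {\<tau>} \<inter> space M) \<inter> ?B"
    unfolding A_def map_upt_eq_iff[OF vs] by auto
  have mem: "\<sigma> n -` {\<tau>} \<inter> space M \<in> {\<sigma> n -` A \<inter> space M | A. True}"
    "?B \<in> {(\<lambda>\<omega>. restrict (\<lambda>j. \<Theta> j \<omega>) {1..}) -` A \<inter> space M | A. A \<in> sets ?PM}"
    using D B[symmetric] by blast+
  show "A \<in> events"
    unfolding A
    by (rule sets.Int[OF subsetD[OF indep_setD_ev1[OF \<sigma>_\<Theta>_indep] mem(1)]
          subsetD[OF indep_setD_ev2[OF \<sigma>_\<Theta>_indep] mem(2)]])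
  have "prob A = prob (\<sigma> n -` {\<tau>} \<inter> space M) * prob ?B"
    unfolding A by (rule indep_setD[OF \<sigma>_\<Theta>_indep mem])
  also have "\<sigma> n -` {\<tau>} \<inter> space M = {\<omega> \<in> space M. \<sigma> n \<omega> = \<tau>}" by auto
  also have "prob {\<omega> \<in> space M. \<sigma> n \<omega> = \<tau>} = 1 / fact n" using \<tau> by (rule \<sigma>_uniform)
  also have "prob ?B = (\<Prod>j\<in>{1..n}. prob {\<omega> \<in> space M. \<Theta> j \<omega> \<in> ?E j})"
    using n h by (intro \<Theta>_prod) auto
  also have "\<dots> = (\<Prod>i<n. prob {\<omega> \<in> space M. h (\<Theta> (Suc i) \<omega>) = vs ! i})"
    by (simp add: prod.atLeast1_atMost_eq)
  finally show "prob A = 1 / fact n * (\<Prod>i<n. prob {\<omega> \<in> space M. h (\<Theta> (Suc i) \<omega>) = vs ! i})" .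
qed

text \<open>\<open>h\<close> turns a threshold into one of finitely many letters, so every event on
  labels and letters is a finite disjoint union of atoms. It is used with one comparison for the law
  at a fixed time and with a vector of comparisons for several times.\<close>

lemma law:
  fixes P :: "nat list \<Rightarrow> 'v list \<Rightarrow> bool" and h :: "real \<Rightarrow> 'v"
  assumes n: "1 \<le> n" and h: "\<And>v. {x. h x = v} \<in> sets borel" "\<And>x. h x \<in> U" "finite U"
  defines "A \<equiv> {\<omega> \<in> space M. P (map (\<sigma> n \<omega>) [1..<Suc n]) (map (\<lambda>j. h (\<Theta> j \<omega>)) [1..<Suc n])}"
  shows "A \<in> events"
    and "prob A = 1 / fact n * (\<Sum>xs\<in>permutations_of_set {1..n}.
      seq_sum U (\<lambda>j v. prob {\<omega> \<in> space M. h (\<Theta> j \<omega>) = v}) n (\<lambda>vs. of_bool (P xs vs)))"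
proof -
  let ?L = "{vs. set vs \<subseteq> U \<and> length vs = n}" and ?S = "{\<tau>. \<tau> permutes {1..n}}"
  let ?l = "\<lambda>\<tau> :: nat \<Rightarrow> nat. map \<tau> [1..<Suc n]"
  let ?q = "\<lambda>j v. prob {\<omega> \<in> space M. h (\<Theta> j \<omega>) = v}"
  define ev where "ev = (\<lambda>(\<tau>, vs). {\<omega> \<in> space M. \<sigma> n \<omega> = \<tau> \<and> map (\<lambda>j. h (\<Theta> j \<omega>)) [1..<Suc n] = vs})"
  define I where "I = {(\<tau>, vs) \<in> ?S \<times> ?L. P (?l \<tau>) vs}"
  have fin: "finite (?S \<times> ?L)"
    using h(3) by (intro finite_cartesian_product finite_permutations finite_lists_length_eq) auto
  then have finI: "finite I" by (rule finite_subset[rotated]) (auto simp: I_def)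
  have A: "A = (\<Union>i\<in>I. ev i)"
    using h(2) \<sigma>_permutes by (auto simp: A_def ev_def I_def simp del: upt_Suc)
  have ev: "ev i \<in> events" "prob (ev i) = 1 / fact n * (\<Prod>k<n. ?q (Suc k) (snd i ! k))"
    if "i \<in> ?S \<times> ?L" for i
    using atom_event_prob[OF n h(1), of "fst i" "snd i"] that by (auto simp: ev_def simp del: upt_Suc)
  have I: "i \<in> ?S \<times> ?L" if "i \<in> I" for i using that by (auto simp: I_def)
  show "A \<in> events"
    unfolding A using ev(1) I finI by (intro sets.finite_UN) auto
  have "prob A = (\<Sum>i\<in>I. prob (ev i))"
    unfolding A using ev(1) I finI
    by (intro finite_measure_finite_Union) (auto simp: disjoint_family_on_def ev_def simp del: upt_Suc)
  also have "\<dots> = (\<Sum>i\<in>I. 1 / fact n * (\<Prod>k<n. ?q (Suc k) (snd i ! k)))"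
    using ev(2) I by (intro sum.cong) auto
  also have "\<dots> = (\<Sum>i\<in>?S \<times> ?L. 1 / fact n * ((\<Prod>k<n. ?q (Suc k) (snd i ! k)) * of_bool (P (?l (fst i)) (snd i))))"
    using fin by (intro sum.mono_neutral_cong_left) (auto simp: I_def simp del: upt_Suc)
  also have "\<dots> = 1 / fact n * (\<Sum>\<tau>\<in>?S. \<Sum>vs\<in>?L. (\<Prod>k<n. ?q (Suc k) (vs ! k)) * of_bool (P (?l \<tau>) vs))"
    by (simp add: sum.cartesian_product sum_distrib_left case_prod_beta del: upt_Suc)
  also have "(\<Sum>\<tau>\<in>?S. \<Sum>vs\<in>?L. (\<Prod>k<n. ?q (Suc k) (vs ! k)) * of_bool (P (?l \<tau>) vs)) =
      (\<Sum>\<tau>\<in>?S. seq_sum U ?q n (\<lambda>vs. of_bool (P (?l \<tau>) vs)))"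
    by (simp only: seq_sum_eq_sum_lists[OF h(3)])
  also have "\<dots> = (\<Sum>xs\<in>permutations_of_set {1..n}. seq_sum U ?q n (\<lambda>vs. of_bool (P xs vs)))"
    by (rule sum.reindex_bij_betw[OF bij_betw_permutes_permutations_of_set])
  finally show "prob A = 1 / fact n * (\<Sum>xs\<in>permutations_of_set {1..n}.
      seq_sum U ?q n (\<lambda>vs. of_bool (P xs vs)))" .
qed

lemma distr_count_space_eqI:
  assumes "X \<in> M \<rightarrow>\<^sub>M count_space UNIV" "Y \<in> M \<rightarrow>\<^sub>M count_space UNIV"
    and "\<And>A. prob {\<omega> \<in> space M. X \<omega> \<in> A} = prob {\<omega> \<in> space M. Y \<omega> \<in> A}"
  shows "distr M (count_space UNIV) X = distr M (count_space UNIV) Y"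
proof (rule measure_eqI)
  fix A
  have eq: "Z -` A \<inter> space M = {\<omega> \<in> space M. Z \<omega> \<in> A}" for Z :: "'a \<Rightarrow> 'b" and A by auto
  show "emeasure (distr M (count_space UNIV) X) A = emeasure (distr M (count_space UNIV) Y) A"
    using assms by (simp add: emeasure_distr eq emeasure_eq_measure)
qed simp

section \<open>Merging two neighbouring thresholds\<close>

text \<open>For \<open>n = 0\<close> the quotient \<open>a / a\<close> is 1 if \<open>a > 0\<close>,
  and the convention supplies 1 at \<open>a = 0\<close>.\<close>

lemma prob_\<Theta>_le:
  assumes "0 \<le> a"
  shows "prob {\<omega> \<in> space M. \<Theta> (Suc n) \<omega> \<le> a} = (if n = 0 then 1 else a / (a + real n))"
  using \<Theta>_cdf[of "Suc n" a] assms by (auto simp: Theta_cdf_def)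

lemma prob_\<Theta>_gt:
  assumes "0 \<le> a"
  shows "prob {\<omega> \<in> space M. \<Theta> (Suc n) \<omega> \<in> {a<..}} = (if n = 0 then 0 else real n / (a + real n))"
proof -
  have "{\<omega> \<in> space M. \<Theta> (Suc n) \<omega> \<in> {a<..}} = space M - {\<omega> \<in> space M. \<Theta> (Suc n) \<omega> \<in> {..a}}"
    by auto
  also have "prob \<dots> = 1 - prob {\<omega> \<in> space M. \<Theta> (Suc n) \<omega> \<in> {..a}}"
    by (intro prob_compl \<Theta>_event) auto
  finally show ?thesis
    using prob_\<Theta>_le[OF assms, of n] assms by (auto simp: field_simps)
qed

text \<open>Merged letters correspond to the minimum of their thresholds. The identity is checked on
  half-lines, where independence factorises the survival function, and extends by additivity.\<close>

lemma prob_min_threshold: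
  assumes ts: "list_all (\<lambda>t. 0 \<le> t) ts"
  defines "h \<equiv> \<lambda>x::real. map (\<lambda>t. x \<le> t) ts"
  shows "real n * prob {\<omega> \<in> space M. h (\<Theta> (Suc (Suc n)) \<omega>) = v} +
    prob {\<omega> \<in> space M. h (min (\<Theta> (Suc n) \<omega>) (\<Theta> (Suc (Suc n)) \<omega>)) = v} =
    real (Suc n) * prob {\<omega> \<in> space M. h (\<Theta> (Suc n) \<omega>) = v}"
proof -
  let ?X = "\<Theta> (Suc n)" and ?Y = "\<Theta> (Suc (Suc n))"
  let ?m = "\<lambda>Z E. prob {\<omega> \<in> space M. Z \<omega> \<in> E}"
  let ?Z = "\<lambda>\<omega>. min (?X \<omega>) (?Y \<omega>)"
  define \<phi> where "\<phi> E = real n * ?m ?Y E + ?m ?Z E - real (Suc n) * ?m ?X E" for E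
  have meas: "?X \<in> borel_measurable M" "?Y \<in> borel_measurable M" "?Z \<in> borel_measurable M"
    using \<Theta>_measurable[of "Suc n"] \<Theta>_measurable[of "Suc (Suc n)"] by auto
  have add: "?m W (E \<union> F) = ?m W E + ?m W F"
    if "W \<in> borel_measurable M" "E \<in> sets borel" "F \<in> sets borel" "E \<inter> F = {}" for W :: "'a \<Rightarrow> real" and E F
  proof -
    have "?m W (E \<union> F) = prob ((W -` E \<inter> space M) \<union> (W -` F \<inter> space M))"
      by (rule arg_cong[where f = prob]) auto
    also have "\<dots> = prob (W -` E \<inter> space M) + prob (W -` F \<inter> space M)"
      using that by (intro finite_measure_Union measurable_sets) auto
    finally show ?thesis by (simp add: vimage_def Int_def conj_commute)
  qed
  have "\<phi> {x. map (\<lambda>t. x \<le> t) ts = v} = 0"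
  proof (rule additive_zero_on_threshold_sets[OF _ _ _ ts])
    show "\<phi> (E \<union> F) = \<phi> E + \<phi> F" if "E \<in> sets borel" "F \<in> sets borel" "E \<inter> F = {}" for E F
      unfolding \<phi>_def add[OF meas(1) that] add[OF meas(2) that] add[OF meas(3) that]
      by (simp add: algebra_simps)
    show "\<phi> UNIV = 0" by (simp add: \<phi>_def prob_space)
    fix a :: real assume a: "0 \<le> a"
    have "{\<omega> \<in> space M. ?Z \<omega> \<in> {..a}} = space M - {\<omega> \<in> space M. ?Z \<omega> \<in> {a<..}}" by auto
    moreover have "{\<omega> \<in> space M. ?Z \<omega> \<in> {a<..}} \<in> events"
      using measurable_sets[OF meas(3), of "{a<..}"] by (simp add: vimage_def Int_def conj_commute)
    ultimately have "?m ?Z {..a} = 1 - ?m ?Z {a<..}"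
      by (simp only: prob_compl)
    also have "{\<omega> \<in> space M. ?Z \<omega> \<in> {a<..}} = {\<omega> \<in> space M. \<forall>j\<in>{Suc n, Suc (Suc n)}. \<Theta> j \<omega> \<in> {a<..}}"
      by auto
    also have "prob \<dots> = ?m ?X {a<..} * ?m ?Y {a<..}"
      by (subst \<Theta>_prod) auto
    finally have Z: "?m ?Z {..a} = 1 - ?m ?X {a<..} * ?m ?Y {a<..}" .
    show "\<phi> {..a} = 0"
    proof (cases "n = 0")
      \<comment> \<open>Here the first threshold is almost surely at most \<open>a\<close>, and so
        is the minimum.\<close>
      case True
      then show ?thesis
        using prob_\<Theta>_le[OF a, of n] unfolding \<phi>_def Z prob_\<Theta>_gt[OF a] by simp
    next
      case False
      define r where "r = real n"
      have r: "r > 0" using False by (simp add: r_def)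
      have "\<phi> {..a} = r * (a / (a + (r + 1))) + (1 - r / (a + r) * ((r + 1) / (a + (r + 1)))) -
          (r + 1) * (a / (a + r))"
        using False prob_\<Theta>_le[OF a, of n] prob_\<Theta>_le[OF a, of "Suc n"]
        unfolding \<phi>_def Z prob_\<Theta>_gt[OF a] by (simp add: r_def add_ac)
      \<comment> \<open>Over the denominator \<open>(a + r) * (a + r + 1)\<close> the first two
        terms have numerator \<open>a * (r + 1) * (a + r + 1)\<close>, since
        \<open>r * (a + r) + (a + 2 * r + 1) = (r + 1) * (a + r + 1)\<close>.\<close>
      also have "\<dots> = 0"
        using r a by (simp add: divide_simps) (simp add: algebra_simps)
      finally show ?thesis .
    qed
  qed
  then show ?thesis by (simp add: \<phi>_def h_def)
qed

text \<open>A change of variables from a pair of independent letters to the merged letter. The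
  behaviour of \<open>f\<close> is known only on letters that some threshold produces.\<close>

lemma prob_pair_threshold:
  fixes h :: "real \<Rightarrow> 'v"
  assumes h: "\<And>v. {x. h x = v} \<in> sets borel" "\<And>x. h x \<in> U" "finite U"
    and f: "\<And>x y. f (h x) (h y) = h (min x y)"
  shows "(\<Sum>u\<in>U. prob {\<omega> \<in> space M. h (\<Theta> (Suc n) \<omega>) = u} *
      (\<Sum>w\<in>U. prob {\<omega> \<in> space M. h (\<Theta> (Suc (Suc n)) \<omega>) = w} * g (f u w))) =
    (\<Sum>v\<in>U. prob {\<omega> \<in> space M. h (min (\<Theta> (Suc n) \<omega>) (\<Theta> (Suc (Suc n)) \<omega>)) = v} * g v)"
proof -
  let ?X = "\<Theta> (Suc n)" and ?Y = "\<Theta> (Suc (Suc n))"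
  define ev where "ev = (\<lambda>(u, w). {\<omega> \<in> space M. h (?X \<omega>) = u \<and> h (?Y \<omega>) = w})"
  have ev: "ev (u, w) \<in> events" "prob (ev (u, w)) =
      prob {\<omega> \<in> space M. h (?X \<omega>) = u} * prob {\<omega> \<in> space M. h (?Y \<omega>) = w}" for u w
  proof -
    let ?E = "\<lambda>j. {x. h x = (if j = Suc n then u else w)}"
    have "ev (u, w) = {\<omega> \<in> space M. \<forall>j\<in>{Suc n, Suc (Suc n)}. \<Theta> j \<omega> \<in> ?E j}"
      by (auto simp: ev_def)
    also have "prob \<dots> = (\<Prod>j\<in>{Suc n, Suc (Suc n)}. prob {\<omega> \<in> space M. \<Theta> j \<omega> \<in> ?E j})"
      using h(1) by (intro \<Theta>_prod) auto
    finally show "prob (ev (u, w)) =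
      prob {\<omega> \<in> space M. h (?X \<omega>) = u} * prob {\<omega> \<in> space M. h (?Y \<omega>) = w}" by simp
    have "ev (u, w) = {\<omega> \<in> space M. ?X \<omega> \<in> {x. h x = u}} \<inter> {\<omega> \<in> space M. ?Y \<omega> \<in> {x. h x = w}}"
      by (auto simp: ev_def)
    also have "\<dots> \<in> events" using h(1) by (intro sets.Int \<Theta>_event) auto
    finally show "ev (u, w) \<in> events" .
  qed
  have min: "prob {\<omega> \<in> space M. h (min (?X \<omega>) (?Y \<omega>)) = v} =
      (\<Sum>i\<in>U \<times> U. if f (fst i) (snd i) = v then prob (ev i) else 0)" for v
  proof -
    let ?I = "{i \<in> U \<times> U. f (fst i) (snd i) = v}"
    have "{\<omega> \<in> space M. h (min (?X \<omega>) (?Y \<omega>)) = v} = (\<Union>i\<in>?I. ev i)"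
      using h(2) by (auto simp: ev_def f)
    also have "prob \<dots> = (\<Sum>i\<in>?I. prob (ev i))"
      using ev(1) h(3)
      by (intro finite_measure_finite_Union) (auto simp: disjoint_family_on_def ev_def)
    also have "\<dots> = (\<Sum>i\<in>U \<times> U. if f (fst i) (snd i) = v then prob (ev i) else 0)"
      using h(3) by (intro sum.inter_filter) auto
    finally show ?thesis .
  qed
  have "(\<Sum>v\<in>U. prob {\<omega> \<in> space M. h (min (?X \<omega>) (?Y \<omega>)) = v} * g v) =
      (\<Sum>i\<in>U \<times> U. \<Sum>v\<in>U. (if f (fst i) (snd i) = v then prob (ev i) else 0) * g v)"
    unfolding min sum_distrib_right by (rule sum.swap)
  also have "\<dots> = (\<Sum>i\<in>U \<times> U. prob (ev i) * g (f (fst i) (snd i)))"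
  proof (rule sum.cong[OF refl])
    fix i assume i: "i \<in> U \<times> U"
    show "(\<Sum>v\<in>U. (if f (fst i) (snd i) = v then prob (ev i) else 0) * g v) =
        prob (ev i) * g (f (fst i) (snd i))"
    proof (cases "f (fst i) (snd i) \<in> U")
      case True
      have "(\<Sum>v\<in>U. (if f (fst i) (snd i) = v then prob (ev i) else 0) * g v) =
          (\<Sum>v\<in>U. if f (fst i) (snd i) = v then prob (ev i) * g v else 0)"
        by (intro sum.cong) auto
      with True h(3) show ?thesis by simp
    next
      \<comment> \<open>A pair produced by thresholds \<open>x\<close>, \<open>y\<close> would merge
        to \<open>h (min x y)\<close>, which lies in \<open>U\<close>; so this pair never
        occurs.\<close>
      case False
      then have "ev i = {}"
        using h(2) by (auto simp: ev_def f split: prod.splits)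
      then show ?thesis by (auto intro!: sum.neutral)
    qed
  qed
  also have "\<dots> = (\<Sum>u\<in>U. \<Sum>w\<in>U. prob (ev (u, w)) * g (f u w))"
    by (simp add: sum.cartesian_product case_prod_beta)
  finally show ?thesis
    by (simp add: ev(2) sum_distrib_left mult_ac)
qed

end

section \<open>The fragmentation process\<close>

text \<open>A letter is now a vector over \<open>r\<close> times, and the \<open>k\<close>-th
  entries of all letters form the word at the \<open>k\<close>-th time. The whole path is thus a
  function of one labelling and one word over a finite alphabet.\<close>

definition box_path :: "nat \<Rightarrow> 'b list \<Rightarrow> bool list list \<Rightarrow> 'b set set list" where
  "box_path r xs vs = map (\<lambda>k. set (boxes xs (map (\<lambda>v. v ! k) vs))) [0..<r]"

lemma Pi_proc_eq_boxes:
  "Pi_proc \<Theta> \<sigma> n \<theta> \<omega> = set (boxes (map (\<sigma> n \<omega>) [1..<Suc n]) (map (\<lambda>j. \<Theta> j \<omega> \<le> \<theta>) [1..<Suc n]))"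
  by (simp add: Pi_proc_def C_proc_def assoc_partition_eq_boxes del: upt_Suc)

lemma Pi_path_eq_box_path:
  "map (\<lambda>t. Pi_proc \<Theta> \<sigma> n t \<omega>) ts =
    box_path (length ts) (map (\<sigma> n \<omega>) [1..<Suc n])
      (map (\<lambda>j. map (\<lambda>t. \<Theta> j \<omega> \<le> t) ts) [1..<Suc n])"
  by (rule nth_equalityI)
    (auto simp: box_path_def Pi_proc_eq_boxes comp_def simp del: upt_Suc)

lemma restrict_part_restrict_part:
  "n \<le> m \<Longrightarrow> restrict_part n (restrict_part m P) = restrict_part n P"
proof -
  assume "n \<le> m"
  then have *: "B \<inter> {1..m} \<inter> {1..n} = B \<inter> {1..n}" for B by auto
  have "(\<lambda>B. B \<inter> {1..n}) ` (Q - {{}}) - {{}} = (\<lambda>B. B \<inter> {1..n}) ` Q - {{}}" for Q :: "nat set set"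
    by blast
  then show ?thesis by (simp only: restrict_part_def image_image *)
qed

text \<open>Equal lengths matter because \<open>map2\<close> truncates to the shorter
  letter.\<close>

lemma map_nth_merge_at:
  assumes "\<And>v. v \<in> set vs \<Longrightarrow> length v = r" "k < r" "p < length vs"
  shows "map (\<lambda>v. v ! k) (merge_at (map2 (\<or>)) p vs) = merge_at (\<or>) p (map (\<lambda>v. v ! k) vs)"
  using assms by (auto simp: merge_at_def take_map drop_map map_butlast)

lemma restrict_part_box_path_insert:
  assumes "length vs = Suc n" "\<And>v. v \<in> set vs \<Longrightarrow> length v = r" "p \<le> n"
    "ys \<in> permutations_of_set {1..n}"
  shows "map (restrict_part n) (box_path r (take p ys @ Suc n # drop p ys) vs) =
    box_path r ys (merge_at (map2 (\<or>)) p vs)"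
  using assms
  by (auto simp: box_path_def restrict_part_boxes_insert map_nth_merge_at[where r = r])

lemma relabel_box_path:
  "length xs = length vs \<Longrightarrow> map (relabel \<tau>) (box_path r xs vs) = box_path r (map \<tau> xs) vs"
  by (auto simp: box_path_def relabel_boxes)

text \<open>The same labelling serves all times and the letters grow with the time for each outcome,
  so refinement holds without an exceptional null set.\<close>

lemma refines_Pi_proc:
  assumes "\<phi> \<le> \<theta>"
  shows "refines (Pi_proc \<Theta> \<sigma> n \<theta> \<omega>) (Pi_proc \<Theta> \<sigma> n \<phi> \<omega>)"
  unfolding Pi_proc_eq_boxes using assms
  by (intro refines_boxes) (auto simp: list_all2_conv_all_nth simp del: upt_Suc)

section \<open>Laws of the partition paths\<close>

context ewens_coupling
begin

abbreviation letter_prob :: "real list \<Rightarrow> nat \<Rightarrow> bool list \<Rightarrow> real" where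
  "letter_prob ts j v \<equiv> prob {\<omega> \<in> space M. map (\<lambda>t. \<Theta> j \<omega> \<le> t) ts = v}"

lemma finite_words: "finite {v :: bool list. length v = r}"
  using finite_lists_length_eq[of "UNIV :: bool set" r] by simp

text \<open>Every subset of the value space counts as measurable, so all preimages must be events.
  This holds because a path depends only on a permutation and a word from finite sets.\<close>

lemma Pi_path:
  assumes "1 \<le> n"
  shows Pi_path_measurable: "(\<lambda>\<omega>. map (\<lambda>t. Pi_proc \<Theta> \<sigma> n t \<omega>) ts) \<in> M \<rightarrow>\<^sub>M count_space UNIV"
    and prob_Pi_path: "prob {\<omega> \<in> space M. map (\<lambda>t. Pi_proc \<Theta> \<sigma> n t \<omega>) ts \<in> A} =
      1 / fact n * (\<Sum>xs\<in>permutations_of_set {1..n}. seq_sum {v. length v = length ts} (letter_prob ts) n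
        (\<lambda>vs. of_bool (box_path (length ts) xs vs \<in> A)))"
proof -
  let ?h = "\<lambda>x. map (\<lambda>t. x \<le> t) ts" and ?U = "{v :: bool list. length v = length ts}"
  note l = law[where h = ?h and U = ?U and P = "\<lambda>xs vs. box_path (length ts) xs vs \<in> B" for B,
      OF assms threshold_set_borel _ finite_words, folded Pi_path_eq_box_path]
  show "(\<lambda>\<omega>. map (\<lambda>t. Pi_proc \<Theta> \<sigma> n t \<omega>) ts) \<in> M \<rightarrow>\<^sub>M count_space UNIV"
  proof (rule measurableI)
    fix B
    have "(\<lambda>\<omega>. map (\<lambda>t. Pi_proc \<Theta> \<sigma> n t \<omega>) ts) -` B \<inter> space M =
        {\<omega> \<in> space M. map (\<lambda>t. Pi_proc \<Theta> \<sigma> n t \<omega>) ts \<in> B}" by auto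
    then show "(\<lambda>\<omega>. map (\<lambda>t. Pi_proc \<Theta> \<sigma> n t \<omega>) ts) -` B \<inter> space M \<in> events"
      using l(1) by simp
  qed simp
  show "prob {\<omega> \<in> space M. map (\<lambda>t. Pi_proc \<Theta> \<sigma> n t \<omega>) ts \<in> A} =
      1 / fact n * (\<Sum>xs\<in>permutations_of_set {1..n}. seq_sum ?U (letter_prob ts) n
        (\<lambda>vs. of_bool (box_path (length ts) xs vs \<in> A)))"
    by (rule l(2)) simp
qed

lemma letter_prob_sum: "(\<Sum>v | length v = length ts. letter_prob ts (Suc n) v) = 1"
proof -
  let ?U = "{v :: bool list. length v = length ts}"
  let ?ev = "\<lambda>v. {\<omega> \<in> space M. map (\<lambda>t. \<Theta> (Suc n) \<omega> \<le> t) ts = v}"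
  have "?ev v \<in> events" for v
    using \<Theta>_event[OF _ threshold_set_borel[of ts v], of "Suc n"] by simp
  then have "prob (\<Union>v\<in>?U. ?ev v) = (\<Sum>v\<in>?U. prob (?ev v))"
    using finite_words by (intro finite_measure_finite_Union) (auto simp: disjoint_family_on_def)
  moreover have "(\<Union>v\<in>?U. ?ev v) = space M" by auto
  ultimately show ?thesis by (simp add: prob_space)
qed

text \<open>The single-letter identity in the form that \<open>sum_seq_sum_merge\<close> asks for:
  entrywise disjunction of two comparison vectors is the comparison vector of the minimum.\<close>

lemma letter_prob_merge:
  assumes "list_all (\<lambda>t. 0 \<le> t) ts"
  shows "real n * (\<Sum>u | length u = length ts. letter_prob ts (Suc (Suc n)) u * g u) +
    (\<Sum>u | length u = length ts. letter_prob ts (Suc n) u *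
      (\<Sum>w | length w = length ts. letter_prob ts (Suc (Suc n)) w * g (map2 (\<or>) u w))) =
    real (Suc n) * (\<Sum>u | length u = length ts. letter_prob ts (Suc n) u * g u)"
proof -
  let ?h = "\<lambda>x. map (\<lambda>t. x \<le> t) ts" and ?U = "{v :: bool list. length v = length ts}"
  have "map2 (\<or>) (?h x) (?h y) = ?h (min x y)" for x y :: real
    by (rule nth_equalityI) (auto simp: min_le_iff_disj)
  then have "(\<Sum>u\<in>?U. letter_prob ts (Suc n) u *
      (\<Sum>w\<in>?U. letter_prob ts (Suc (Suc n)) w * g (map2 (\<or>) u w))) =
    (\<Sum>v\<in>?U. prob {\<omega> \<in> space M. ?h (min (\<Theta> (Suc n) \<omega>) (\<Theta> (Suc (Suc n)) \<omega>)) = v} * g v)"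
    using finite_words by (intro prob_pair_threshold threshold_set_borel) auto
  then show ?thesis
    using prob_min_threshold[OF assms, of n]
    by (simp only: sum_distrib_left mult.assoc[symmetric] sum.distrib[symmetric]
        distrib_right[symmetric])
qed

lemma restrict_Pi_path_Suc:
  assumes n: "1 \<le> n" and ts: "list_all (\<lambda>t. 0 \<le> t) ts"
  shows "distr M (count_space UNIV) (\<lambda>\<omega>. map (\<lambda>t. restrict_part n (Pi_proc \<Theta> \<sigma> (Suc n) t \<omega>)) ts) =
    distr M (count_space UNIV) (\<lambda>\<omega>. map (\<lambda>t. Pi_proc \<Theta> \<sigma> n t \<omega>) ts)"
proof -
  let ?U = "{v :: bool list. length v = length ts}" and ?r = "length ts" and ?q = "letter_prob ts"
  let ?or = "map2 (\<or>)"
  let ?X = "\<lambda>\<omega>. map (\<lambda>t. Pi_proc \<Theta> \<sigma> (Suc n) t \<omega>) ts"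
  let ?Y = "\<lambda>\<omega>. map (\<lambda>t. Pi_proc \<Theta> \<sigma> n t \<omega>) ts"
  have X: "(\<lambda>\<omega>. map (\<lambda>t. restrict_part n (Pi_proc \<Theta> \<sigma> (Suc n) t \<omega>)) ts) =
      (\<lambda>\<omega>. map (restrict_part n) (?X \<omega>))" by (simp add: comp_def)
  have meas: "?X \<in> M \<rightarrow>\<^sub>M count_space UNIV" "?Y \<in> M \<rightarrow>\<^sub>M count_space UNIV"
    using n by (auto intro!: Pi_path_measurable)
  have "prob {\<omega> \<in> space M. map (restrict_part n) (?X \<omega>) \<in> A} = prob {\<omega> \<in> space M. ?Y \<omega> \<in> A}" for A
  proof -
    let ?g = "\<lambda>ys vs. of_bool (box_path ?r ys vs \<in> A) :: real"
    have "prob {\<omega> \<in> space M. map (restrict_part n) (?X \<omega>) \<in> A} =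
        prob {\<omega> \<in> space M. ?X \<omega> \<in> map (restrict_part n) -` A}" by (simp only: vimage_eq)
    also have "\<dots> = 1 / fact (Suc n) * (\<Sum>xs\<in>permutations_of_set {1..Suc n}. seq_sum ?U ?q (Suc n)
        (\<lambda>vs. of_bool (map (restrict_part n) (box_path ?r xs vs) \<in> A)))"
      by (subst prob_Pi_path) (simp_all only: vimage_eq)
    \<comment> \<open>Separates the position of the label to be deleted from the order of the
      others.\<close>
    also have "{1..Suc n} = insert (Suc n) {1..n}" by auto
    also have "(\<Sum>xs\<in>permutations_of_set (insert (Suc n) {1..n}). seq_sum ?U ?q (Suc n)
        (\<lambda>vs. of_bool (map (restrict_part n) (box_path ?r xs vs) \<in> A))) =
      (\<Sum>ys\<in>permutations_of_set {1..n}. \<Sum>p\<le>card {1..n}. seq_sum ?U ?q (Suc n)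
        (\<lambda>vs. of_bool (map (restrict_part n) (box_path ?r (take p ys @ Suc n # drop p ys) vs) \<in> A)))"
      by (rule sum_permutations_of_set_insert) auto
    also have "\<dots> = (\<Sum>ys\<in>permutations_of_set {1..n}. \<Sum>p\<le>n. seq_sum ?U ?q (Suc n)
        (\<lambda>vs. ?g ys (merge_at ?or p vs)))"
      by (intro sum.cong seq_sum_cong) (auto simp: restrict_part_box_path_insert subset_iff)
    also have "\<dots> = (\<Sum>ys\<in>permutations_of_set {1..n}. real (Suc n) * seq_sum ?U ?q n (?g ys))"
      by (intro sum.cong refl sum_seq_sum_merge letter_prob_merge[OF ts] letter_prob_sum)
    \<comment> \<open>The factor contributed by the \<open>n + 1\<close> positions cancels against
      \<open>fact (Suc n)\<close>.\<close>
    also have "1 / fact (Suc n) * \<dots> = 1 / fact n * (\<Sum>ys\<in>permutations_of_set {1..n}. seq_sum ?U ?q n (?g ys))"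
      by (simp add: sum_distrib_left[symmetric] del: of_nat_Suc)
    also have "\<dots> = prob {\<omega> \<in> space M. ?Y \<omega> \<in> A}"
      using n by (simp add: prob_Pi_path)
    finally show ?thesis .
  qed
  then show ?thesis
    unfolding X by (intro distr_count_space_eqI measurable_compose[OF meas(1)] meas(2)) auto
qed

text \<open>The permutations for different sizes are not coupled, so the one-step statements are
  equalities of laws only. They are chained by pushing forward along the restriction to
  \<open>{1..n}\<close>.\<close>

lemma restrict_Pi_path:
  assumes n: "1 \<le> n" and "n < m" and ts: "list_all (\<lambda>t. 0 \<le> t) ts"
  shows "distr M (count_space UNIV) (\<lambda>\<omega>. map (\<lambda>t. restrict_part n (Pi_proc \<Theta> \<sigma> m t \<omega>)) ts) =
    distr M (count_space UNIV) (\<lambda>\<omega>. map (\<lambda>t. Pi_proc \<Theta> \<sigma> n t \<omega>) ts)"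
  using Suc_leI[OF \<open>n < m\<close>]
proof (induction m rule: dec_induct)
  case base
  show ?case using n ts by (rule restrict_Pi_path_Suc)
next
  case (step m)
  let ?C = "count_space UNIV :: nat set set list measure"
  let ?X = "\<lambda>m \<omega>. map (\<lambda>t. Pi_proc \<Theta> \<sigma> m t \<omega>) ts"
  have m: "1 \<le> m" "n \<le> m" using step.hyps n by auto
  have meas: "?X k \<in> M \<rightarrow>\<^sub>M ?C" if "1 \<le> k" for k using that by (rule Pi_path_measurable)
  have eq: "(\<lambda>\<omega>. map (\<lambda>t. restrict_part k (Pi_proc \<Theta> \<sigma> l t \<omega>)) ts) = map (restrict_part k) \<circ> ?X l" for k l
    by (simp add: comp_def)
  have "map (restrict_part n) \<circ> ?X (Suc m) = map (restrict_part n) \<circ> (map (restrict_part m) \<circ> ?X (Suc m))"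
    using m by (simp add: comp_def restrict_part_restrict_part)
  then have "distr M ?C (map (restrict_part n) \<circ> ?X (Suc m)) =
      distr (distr M ?C (map (restrict_part m) \<circ> ?X (Suc m))) ?C (map (restrict_part n))"
    using meas[of "Suc m"] by (subst distr_distr) (auto intro: measurable_comp)
  also have "distr M ?C (map (restrict_part m) \<circ> ?X (Suc m)) = distr M ?C (?X m)"
    using restrict_Pi_path_Suc[OF m(1) ts] unfolding eq .
  also have "distr (distr M ?C (?X m)) ?C (map (restrict_part n)) = distr M ?C (map (restrict_part n) \<circ> ?X m)"
    using meas[OF m(1)] by (subst distr_distr) auto
  also have "\<dots> = distr M ?C (?X n)" using step.IH unfolding eq .
  finally show ?case unfolding eq .
qed

lemma relabel_Pi_path:
  assumes n: "1 \<le> n" and \<tau>: "\<tau> permutes {1..n}"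
  shows "distr M (count_space UNIV) (\<lambda>\<omega>. map (\<lambda>t. relabel \<tau> (Pi_proc \<Theta> \<sigma> n t \<omega>)) ts) =
    distr M (count_space UNIV) (\<lambda>\<omega>. map (\<lambda>t. Pi_proc \<Theta> \<sigma> n t \<omega>) ts)"
proof -
  let ?U = "{v :: bool list. length v = length ts}" and ?r = "length ts" and ?q = "letter_prob ts"
  let ?X = "\<lambda>\<omega>. map (\<lambda>t. Pi_proc \<Theta> \<sigma> n t \<omega>) ts"
  let ?S = "permutations_of_set {1..n}"
  have X: "(\<lambda>\<omega>. map (\<lambda>t. relabel \<tau> (Pi_proc \<Theta> \<sigma> n t \<omega>)) ts) =
      (\<lambda>\<omega>. map (relabel \<tau>) (?X \<omega>))" by (simp add: comp_def)
  have meas: "?X \<in> M \<rightarrow>\<^sub>M count_space UNIV"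
    using n by (rule Pi_path_measurable)
  have bij: "bij_betw (map \<tau>) ?S ?S"
    using permutations_of_set_image_permutes[OF \<tau>] permutes_inj[OF \<tau>]
    by (auto simp: bij_betw_def intro: inj_on_subset)
  have "prob {\<omega> \<in> space M. map (relabel \<tau>) (?X \<omega>) \<in> A} = prob {\<omega> \<in> space M. ?X \<omega> \<in> A}" for A
  proof -
    let ?g = "\<lambda>xs. seq_sum ?U ?q n (\<lambda>vs. of_bool (box_path ?r xs vs \<in> A))"
    have "prob {\<omega> \<in> space M. map (relabel \<tau>) (?X \<omega>) \<in> A} =
        prob {\<omega> \<in> space M. ?X \<omega> \<in> map (relabel \<tau>) -` A}" by (simp only: vimage_eq)
    also have "\<dots> = 1 / fact n * (\<Sum>xs\<in>?S. seq_sum ?U ?q n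
        (\<lambda>vs. of_bool (map (relabel \<tau>) (box_path ?r xs vs) \<in> A)))"
      using n by (subst prob_Pi_path) (simp_all only: vimage_eq)
    also have "(\<Sum>xs\<in>?S. seq_sum ?U ?q n
        (\<lambda>vs. of_bool (map (relabel \<tau>) (box_path ?r xs vs) \<in> A))) = (\<Sum>xs\<in>?S. ?g (map \<tau> xs))"
      by (intro sum.cong seq_sum_cong)
        (auto simp: relabel_box_path length_finite_permutations_of_set)
    also have "\<dots> = (\<Sum>xs\<in>?S. ?g xs)"
      by (rule sum.reindex_bij_betw[OF bij])
    finally show ?thesis using n by (simp add: prob_Pi_path)
  qed
  then show ?thesis
    unfolding X by (intro distr_count_space_eqI measurable_compose[OF meas] meas) auto
qed

text \<open>A single time needs only Boolean letters. The first letter is almost surely 1, also at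
  \<theta> = 0.\<close>

lemma prob_Pi_proc:
  assumes n: "1 \<le> n" and \<theta>: "0 \<le> \<theta>" and P: "partition_on {1..n} P"
  shows "prob {\<omega> \<in> space M. Pi_proc \<Theta> \<sigma> n \<theta> \<omega> = P} =
    \<theta> ^ (card P - 1) / pochhammer (\<theta> + 1) (n - 1) * (\<Prod>B\<in>P. fact (card B - 1))"
proof -
  let ?q = "\<lambda>j b. prob {\<omega> \<in> space M. (\<Theta> j \<omega> \<le> \<theta>) = b}"
  have T: "?q (Suc k) True = (if k = 0 then 1 else \<theta> / (\<theta> + real k))" for k
    using prob_\<Theta>_le[OF \<theta>, of k] by simp
  have F: "?q (Suc k) False = (if k = 0 then 0 else real k / (\<theta> + real k))" for k
    using prob_\<Theta>_gt[OF \<theta>, of k] by (simp add: not_le)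
  have h: "{x. (x \<le> \<theta>) = b} \<in> sets borel" for b
  proof -
    have "{x. (x \<le> \<theta>) = b} = (if b then {..\<theta>} else {\<theta><..})" by auto
    then show ?thesis by simp
  qed
  have "prob {\<omega> \<in> space M. Pi_proc \<Theta> \<sigma> n \<theta> \<omega> = P} =
      1 / fact n * (\<Sum>xs\<in>permutations_of_set {1..n}. seq_sum UNIV ?q n (\<lambda>bs. of_bool (set (boxes xs bs) = P)))"
    unfolding Pi_proc_eq_boxes
    by (rule law(2)[where h = "\<lambda>x. x \<le> \<theta>" and P = "\<lambda>xs bs. set (boxes xs bs) = P", OF n h]) auto
  also have "(\<Sum>xs\<in>permutations_of_set {1..n}. seq_sum UNIV ?q n (\<lambda>bs. of_bool (set (boxes xs bs) = P))) =
      fact n * (\<theta> ^ (card P - 1) / pochhammer (\<theta> + 1) (n - 1) * (\<Prod>C\<in>P. fact (card C - 1)))"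
    using T F T[of 0] F[of 0] n by (intro sum_boxes_eq_ewens \<theta> P) auto
  finally show ?thesis by simp
qed

theorem ewens_fragmentation_family_Pi_proc: "ewens_fragmentation_family M (Pi_proc \<Theta> \<sigma>)"
  unfolding ewens_fragmentation_family_def
  using prob_Pi_proc refines_Pi_proc[OF less_imp_le] restrict_Pi_path relabel_Pi_path
  by (auto intro!: AE_I2)

end

theorem theorem1:
  fixes M :: "'a measure" and \<Theta> :: "nat \<Rightarrow> 'a \<Rightarrow> real" and \<sigma> :: "nat \<Rightarrow> 'a \<Rightarrow> nat \<Rightarrow> nat"
  assumes "prob_space M"
    and "\<And>j. 1 \<le> j \<Longrightarrow> \<Theta> j \<in> borel_measurable M"
    and "prob_space.indep_vars M (\<lambda>_. borel) \<Theta> {1..}"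
    and "\<And>j \<theta>. 1 \<le> j \<Longrightarrow> 0 \<le> \<theta> \<Longrightarrow> measure M {\<omega> \<in> space M. \<Theta> j \<omega> \<le> \<theta>} = Theta_cdf j \<theta>"
    and "\<And>n. \<sigma> n \<in> M \<rightarrow>\<^sub>M count_space UNIV"
    and "\<And>n \<omega>. \<omega> \<in> space M \<Longrightarrow> \<sigma> n \<omega> permutes {1..n}"
    and "\<And>n \<tau>. \<tau> permutes {1..n} \<Longrightarrow> measure M {\<omega> \<in> space M. \<sigma> n \<omega> = \<tau>} = 1 / fact n"
    and "\<And>n. prob_space.indep_set M
               {\<sigma> n -` A \<inter> space M | A. True}
               {(\<lambda>\<omega>. restrict (\<lambda>j. \<Theta> j \<omega>) {1..}) -` A \<inter> space M | A. A \<in> sets (PiM {1..} (\<lambda>_. borel))}"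
  shows "ewens_fragmentation_family M (Pi_proc \<Theta> \<sigma>)"
proof -
  interpret prob_space M by fact
  interpret ewens_coupling M \<Theta> \<sigma>
    using assms(2-) by unfold_locales auto
  show ?thesis by (rule ewens_fragmentation_family_Pi_proc)
qed

end
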